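(* For any nonlocal game $\mathcal G(\pi,V)$, and for a convex cone $\mathcal K$ let $(\mathcal F_{\mathcal K})$ denote the conic feasibility problem: find $X\in\mathcal K$ such that $\langle J_{i,j},X\rangle=1$ for all $i,j\in S\cup T$, and $X[(s,a),(t,b)]=0$ for all $a,b,s,t$ with $\pi(s,t)>0$ and $V(a,b|s,t)=0$. Then: (i) $\mathcal G$ admits a perfect classical strategy if and only if $(\mathcal F_{\mathcal{CP}})$ is feasible; (ii) $\mathcal G$ admits a perfect quantum strategy if and only if $(\mathcal F_{\mathcal{CS}_+})$ is feasible; (iii) $\mathcal G$ admits a perfect no-signaling strategy if and only if $(\mathcal F_{\mathcal{NSO}})$ is feasible; (iv) $\mathcal G$ admits a perfect unrestricted strategy if and only if $(\mathcal F_{\mathcal N})$ is feasible.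
   Context: A nonlocal game $\mathcal G(\pi,V)$ consists of finite nonempty sets $S,T$ (questions), $A,B$ (answers), a probability distribution $\pi$ on $S\times T$ and a predicate $V:A\times B\times S\times T\to\{0,1\}$, written $V(a,b|s,t)$. It admits a perfect classical (resp. quantum, no-signaling, unrestricted) strategy if there is $p$ in $\mathcal C$ (resp. $\mathcal Q$, $\mathcal{NS}$, $\mathcal P$) with $\sum_{s,t}\pi(s,t)\sum_{a,b}V(a,b|s,t)p(a,b|s,t)=1$. Correlation sets. $\mathcal{P}$: vectors $p=(p(a,b|s,t))$ with $p(a,b|s,t)\ge 0$ and $\sum_{a,b}p(a,b|s,t)=1$ for all $s,t$. $\mathcal{C}$: $p\in\mathcal P$ such that for some $n$ there are nonnegative reals $k_i,x_a^{s,i},y_b^{t,i}$ ($i\in[n]$) with $\sum_i k_i=1$, $\sum_a x_a^{s,i}=\sum_b y_b^{t,i}=1$ for all $s,t,i$, and $p(a,b|s,t)=\sum_{i=1}^n k_i x_a^{s,i}y_b^{t,i}$. $\mathcal{Q}$: $p\in\mathcal P$ such that there are finite-dimensional complex Euclidean spaces $\mathcal X,\mathcal Y$, a unit vector $\psi\in\mathcal X\otimes\mathcal Y$, Hermitian psd operators $X_a^s$ on $\mathcal X$ with $\sum_a X_a^s=\mathbb I_{\mathcal X}$ for each $s$, and Hermitian psd $Y_b^t$ on $\mathcal Y$ with $\sum_b Y_b^t=\mathbb I_{\mathcal Y}$ for each $t$, with $p(a,b|s,t)=\psi^*(X_a^s\otimes Y_b^t)\psi$. $\mathcal{NS}$: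 $p\in\mathcal P$ with $\sum_b p(a,b|s,t)=\sum_b p(a,b|s,t')$ for all $a,s,t\neq t'$, and $\sum_a p(a,b|s,t)=\sum_a p(a,b|s',t)$ for all $b,t,s\ne s'$. Let $N=|S||A|+|T||B|$; real symmetric $N\times N$ matrices are indexed by the disjoint union of $S\times A$ and $T\times B$ (in $S\cup T$, $S$ and $T$ are regarded as disjoint). $\langle J_{i,j},X\rangle:=\sum_{k,l}X[(i,k),(j,l)]$ is the sum of entries in block $(i,j)$, $i,j\in S\cup T$. Cones (all of size $N$). $\mathcal N$: entrywise nonnegative symmetric matrices. $\mathcal{CP}$: Gram matrices $(\langle x_i,x_j\rangle)$ of vectors $x_i\in\mathbb R^d_+$ (some $d\ge1$). $\mathcal{CS}_+$: matrices $(\mathrm{Tr}(X_iX_j))$ with $X_i$ real symmetric psd $d\times d$ (some $d\ge1$). $\mathcal{NSO}$: $X\in\mathcal N$ with $\sum_{a}X[(s,a),(t,b)]=\sum_{a}X[(s',a),(t,b)]$ for all $b,t,s\neq s'$, and $\sum_{b}X[(s,a),(t,b)]=\sum_{b}X[(s,a),(t',b)]$ for all $a,s,t\ne t'$. *)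

theory Defs
  imports Complex_Main "Jordan_Normal_Form.Schur_Decomposition"
begin

section \<open>Nonlocal games and correlation sets\<close>

text \<open>
  The question sets \<open>S\<close>, \<open>T\<close> and the answer sets \<open>A\<close>, \<open>B\<close> are the universes of types
  \<open>'s\<close>, \<open>'t\<close>, \<open>'a\<close>, \<open>'b\<close> of class \<open>finite\<close> (hence finite and nonempty).  The value
  \<open>p a b s t\<close> stands for $p(a,b|s,t)$, and \<open>V a b s t\<close> for $V(a,b|s,t) = 1$.
\<close>

type_synonym ('a, 'b, 's, 't) correlation = "'a \<Rightarrow> 'b \<Rightarrow> 's \<Rightarrow> 't \<Rightarrow> real"

definition prob_distribution :: "('s::finite \<Rightarrow> 't::finite \<Rightarrow> real) \<Rightarrow> bool" where
  "prob_distribution \<pi> \<longleftrightarrow>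
     (\<forall>s t. 0 \<le> \<pi> s t) \<and> (\<Sum>s\<in>UNIV. \<Sum>t\<in>UNIV. \<pi> s t) = 1"

definition unrestricted_correlations ::
  "('a::finite, 'b::finite, 's::finite, 't::finite) correlation set" where
  "unrestricted_correlations =
     {p. (\<forall>a b s t. 0 \<le> p a b s t) \<and> (\<forall>s t. (\<Sum>a\<in>UNIV. \<Sum>b\<in>UNIV. p a b s t) = 1)}"

definition classical_correlations ::
  "('a::finite, 'b::finite, 's::finite, 't::finite) correlation set" where
  "classical_correlations =
     {p \<in> unrestricted_correlations.
        \<exists>(n::nat) (k :: nat \<Rightarrow> real) (x :: 's \<Rightarrow> 'a \<Rightarrow> nat \<Rightarrow> real) (y :: 't \<Rightarrow> 'b \<Rightarrow> nat \<Rightarrow> real).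
          (\<forall>i<n. 0 \<le> k i \<and> (\<forall>s a. 0 \<le> x s a i) \<and> (\<forall>t b. 0 \<le> y t b i)) \<and>
          (\<Sum>i<n. k i) = 1 \<and>
          (\<forall>i<n. \<forall>s. (\<Sum>a\<in>UNIV. x s a i) = 1) \<and>
          (\<forall>i<n. \<forall>t. (\<Sum>b\<in>UNIV. y t b i) = 1) \<and>
          (\<forall>a b s t. p a b s t = (\<Sum>i<n. k i * x s a i * y t b i))}"

definition no_signaling_correlations ::
  "('a::finite, 'b::finite, 's::finite, 't::finite) correlation set" where
  "no_signaling_correlations =
     {p \<in> unrestricted_correlations.
        (\<forall>a s t t'. t \<noteq> t' \<longrightarrow> (\<Sum>b\<in>UNIV. p a b s t) = (\<Sum>b\<in>UNIV. p a b s t')) \<and>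
        (\<forall>b t s s'. s \<noteq> s' \<longrightarrow> (\<Sum>a\<in>UNIV. p a b s t) = (\<Sum>a\<in>UNIV. p a b s' t))}"

text \<open>
  Finite-dimensional spaces are $\mathbb{C}^n$ (or $\mathbb{R}^n$) with a natural number \<open>n\<close>, since
  the dimension is existentially quantified.  Over the reals \<open>conjugate\<close> is the identity, so
  \<open>psd_mat\<close> specialises to symmetric positive semidefinite matrices; over the complex numbers
  \<open>0 \<le> z\<close> says that \<open>z\<close> is real and nonnegative.
\<close>

definition psd_mat :: "nat \<Rightarrow> 'k::conjugatable_ordered_field mat \<Rightarrow> bool" where
  "psd_mat n M \<longleftrightarrow>
     M \<in> carrier_mat n n \<and> mat_adjoint M = M \<and>
     (\<forall>v\<in>carrier_vec n. 0 \<le> (M *\<^sub>v v) \<bullet>c v)"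

definition mat_trace :: "'k::comm_monoid_add mat \<Rightarrow> 'k" where
  "mat_trace M = (\<Sum>i<dim_row M. M $$ (i, i))"

text \<open>The sum over a finite type of matrices from \<open>carrier_mat n n\<close>.\<close>

definition mat_sum :: "nat \<Rightarrow> ('i::finite \<Rightarrow> 'k::comm_monoid_add mat) \<Rightarrow> 'k mat" where
  "mat_sum n F = mat n n (\<lambda>ij. \<Sum>i\<in>UNIV. F i $$ ij)"

text \<open>
  Kronecker product; $\mathbb{C}^n \otimes \mathbb{C}^m$ is identified with $\mathbb{C}^{nm}$ by
  $e_i \otimes e_j \mapsto e_{im+j}$.
\<close>

definition tensor_mat :: "'k::times mat \<Rightarrow> 'k mat \<Rightarrow> 'k mat" where
  "tensor_mat M L =
     mat (dim_row M * dim_row L) (dim_col M * dim_col L)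
       (\<lambda>(i, j). M $$ (i div dim_row L, j div dim_col L) * L $$ (i mod dim_row L, j mod dim_col L))"

definition quantum_correlations ::
  "('a::finite, 'b::finite, 's::finite, 't::finite) correlation set" where
  "quantum_correlations =
     {p \<in> unrestricted_correlations.
        \<exists>(n::nat) (m::nat) (\<psi> :: complex vec)
         (X :: 's \<Rightarrow> 'a \<Rightarrow> complex mat) (Y :: 't \<Rightarrow> 'b \<Rightarrow> complex mat).
          \<psi> \<in> carrier_vec (n * m) \<and> \<psi> \<bullet>c \<psi> = 1 \<and>
          (\<forall>s a. psd_mat n (X s a)) \<and> (\<forall>s. mat_sum n (X s) = 1\<^sub>m n) \<and>
          (\<forall>t b. psd_mat m (Y t b)) \<and> (\<forall>t. mat_sum m (Y t) = 1\<^sub>m m) \<and>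
          (\<forall>a b s t. complex_of_real (p a b s t) = (tensor_mat (X s a) (Y t b) *\<^sub>v \<psi>) \<bullet>c \<psi>)}"

definition admits_perfect_strategy ::
  "('a::finite, 'b::finite, 's::finite, 't::finite) correlation set \<Rightarrow>
   ('s \<Rightarrow> 't \<Rightarrow> real) \<Rightarrow> ('a \<Rightarrow> 'b \<Rightarrow> 's \<Rightarrow> 't \<Rightarrow> bool) \<Rightarrow> bool" where
  "admits_perfect_strategy \<C> \<pi> V \<longleftrightarrow>
     (\<exists>p\<in>\<C>. (\<Sum>s\<in>UNIV. \<Sum>t\<in>UNIV. \<pi> s t *
                (\<Sum>a\<in>UNIV. \<Sum>b\<in>UNIV. of_bool (V a b s t) * p a b s t)) = 1)"

section \<open>Cones and the conic feasibility problem\<close>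

type_synonym ('a, 'b, 's, 't) index = "'s \<times> 'a + 't \<times> 'b"

type_synonym ('a, 'b, 's, 't) game_matrix =
  "('a, 'b, 's, 't) index \<Rightarrow> ('a, 'b, 's, 't) index \<Rightarrow> real"

definition nonneg_cone :: "('a::finite, 'b::finite, 's::finite, 't::finite) game_matrix set" where
  "nonneg_cone = {X. (\<forall>u v. X u v = X v u) \<and> (\<forall>u v. 0 \<le> X u v)}"

definition cp_cone :: "('a::finite, 'b::finite, 's::finite, 't::finite) game_matrix set" where
  "cp_cone =
     {X. \<exists>d\<ge>1. \<exists>x :: ('a, 'b, 's, 't) index \<Rightarrow> real vec.
           (\<forall>u. x u \<in> carrier_vec d \<and> (\<forall>i<d. 0 \<le> x u $ i)) \<and>
           (\<forall>u v. X u v = x u \<bullet> x v)}"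

definition cs_plus_cone :: "('a::finite, 'b::finite, 's::finite, 't::finite) game_matrix set" where
  "cs_plus_cone =
     {X. \<exists>d\<ge>1. \<exists>M :: ('a, 'b, 's, 't) index \<Rightarrow> real mat.
           (\<forall>u. psd_mat d (M u)) \<and> (\<forall>u v. X u v = mat_trace (M u * M v))}"

definition nso_cone :: "('a::finite, 'b::finite, 's::finite, 't::finite) game_matrix set" where
  "nso_cone =
     {X \<in> nonneg_cone.
        (\<forall>b t s s'. s \<noteq> s' \<longrightarrow>
           (\<Sum>a\<in>UNIV. X (Inl (s, a)) (Inr (t, b))) = (\<Sum>a\<in>UNIV. X (Inl (s', a)) (Inr (t, b)))) \<and>
        (\<forall>a s t t'. t \<noteq> t' \<longrightarrow>
           (\<Sum>b\<in>UNIV. X (Inl (s, a)) (Inr (t, b))) = (\<Sum>b\<in>UNIV. X (Inl (s, a)) (Inr (t', b))))}"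

fun block :: "'s + 't \<Rightarrow> ('a, 'b, 's, 't) index set" where
  "block (Inl s) = {Inl (s, a) | a. True}"
| "block (Inr t) = {Inr (t, b) | b. True}"

text \<open>$\langle J_{i,j}, X\rangle$, the sum of the entries of \<open>X\<close> in block $(i,j)$.\<close>

definition block_sum ::
  "'s + 't \<Rightarrow> 's + 't \<Rightarrow> ('a::finite, 'b::finite, 's::finite, 't::finite) game_matrix \<Rightarrow> real" where
  "block_sum i j X = (\<Sum>u\<in>block i. \<Sum>v\<in>block j. X u v)"

definition conic_feasible ::
  "('a::finite, 'b::finite, 's::finite, 't::finite) game_matrix set \<Rightarrow>
   ('s \<Rightarrow> 't \<Rightarrow> real) \<Rightarrow> ('a \<Rightarrow> 'b \<Rightarrow> 's \<Rightarrow> 't \<Rightarrow> bool) \<Rightarrow> bool" where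
  "conic_feasible \<K> \<pi> V \<longleftrightarrow>
     (\<exists>X\<in>\<K>.
        (\<forall>i j. block_sum i j X = 1) \<and>
        (\<forall>a b s t. \<pi> s t > 0 \<and> \<not> V a b s t \<longrightarrow> X (Inl (s, a)) (Inr (t, b)) = 0))"

end

theory Submission
  imports Defs "Jordan_Normal_Form.Spectral_Radius"
begin

text \<open>
  A correlation is perfect iff it vanishes where \<open>\<pi>\<close> is positive and \<open>V\<close> is false, so for each pair
  of sets it suffices to pass between correlations and the off-diagonal blocks of matrices with all
  block sums 1.  For the entrywise nonnegative cones the diagonal blocks are filled uniformly.  In a
  feasible Gram representation the block sums of the vectors are unit vectors with pairwise
  inner products 1, hence all equal.  In the completely positive case the squared entries of this
  common vector are the
  weights of the convex combination.

  In the quantum case both sides are compared with a balanced form: complex positive semidefinite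
  $M^s_a$, $N^t_b$ with $\sum_a M^s_a = \sum_b N^t_b = D$, where $D$ is a nonnegative diagonal
  matrix with $\mathrm{Tr}(D^2) = 1$, and $p(a,b|s,t) = \mathrm{Tr}(M^s_a N^t_b)$.  A
  strategy $(\psi, X, Y)$ yields one by diagonalising $\Psi\Psi^*$, where $\Psi$ is the matrix of
  $\psi$, so that $D$ carries the Schmidt coefficients, and setting $M = D^{1/2} X D^{1/2}$; conversely
  $X = D^{-1/2} M D^{-1/2}$ is a measurement on the support of $D$, and $\psi$ is the vectorisation of
  $D$.  A matrix in the completely positive semidefinite cone yields one by
  diagonalising the common block sum.
  Conversely, the block matrix with rows $(\mathrm{Re}\,M, -\mathrm{Im}\,M)$ and
  $(\mathrm{Im}\,M, \mathrm{Re}\,M)$, divided by $\sqrt 2$, makes a complex $M$ real and preserves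
  $\mathrm{Tr}(MN)$ for positive semidefinite matrices.
\<close>

section \<open>Adjoints and positive semidefinite matrices\<close>

lemma dim_mat_adjoint [simp]:
  "dim_row (mat_adjoint A) = dim_col A" "dim_col (mat_adjoint A) = dim_row A"
  by (simp_all add: mat_adjoint_def mat_of_rows_def)

lemma mat_adjoint_carrier [simp]: "A \<in> carrier_mat n m \<Longrightarrow> mat_adjoint A \<in> carrier_mat m n"
  by auto

lemma index_mat_adjoint [simp]:
  "i < dim_col A \<Longrightarrow> j < dim_row A \<Longrightarrow> mat_adjoint A $$ (i, j) = conjugate (A $$ (j, i))"
  by (simp add: mat_adjoint_def mat_of_rows_def)

lemma mat_adjoint_adjoint [simp]: "mat_adjoint (mat_adjoint A) = A"
  by (rule eq_matI) auto

lemma mat_adjoint_mult: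
  assumes "A \<in> carrier_mat n k" "B \<in> carrier_mat k m"
  shows "mat_adjoint (A * B) = mat_adjoint B * mat_adjoint A"
  using assms
  by (intro eq_matI)
    (auto simp: scalar_prod_def sum_conjugate conjugate_dist_mul mult.commute intro!: sum.cong)

lemma cscalar_prod_sum:
  "dim_vec v = n \<Longrightarrow> w \<bullet>c v = (\<Sum>i<n. w $ i * conjugate (v $ i))"
  by (auto simp: scalar_prod_def atLeast0LessThan intro!: sum.cong)

lemma mult_mat_vec_index:
  "A \<in> carrier_mat n m \<Longrightarrow> v \<in> carrier_vec m \<Longrightarrow> i < n \<Longrightarrow>
    (A *\<^sub>v v) $ i = (\<Sum>j<m. A $$ (i, j) * v $ j)"
  by (auto simp: scalar_prod_def atLeast0LessThan)

lemma mult_mat_index: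
  "A \<in> carrier_mat n m \<Longrightarrow> B \<in> carrier_mat m k \<Longrightarrow> i < n \<Longrightarrow> j < k \<Longrightarrow>
    (A * B) $$ (i, j) = (\<Sum>l<m. A $$ (i, l) * B $$ (l, j))"
  by (auto simp: scalar_prod_def atLeast0LessThan)

lemma quadratic_form_sum:
  assumes "A \<in> carrier_mat n n" "v \<in> carrier_vec n"
  shows "(A *\<^sub>v v) \<bullet>c v = (\<Sum>i<n. \<Sum>j<n. A $$ (i, j) * v $ j * conjugate (v $ i))"
  using assms
  by (simp add: cscalar_prod_sum[of v n] mult_mat_vec_index sum_distrib_right del: index_mult_mat_vec)

lemma adjoint_cscalar_prod:
  assumes "P \<in> carrier_mat n k" "w \<in> carrier_vec n" "v \<in> carrier_vec k"
  shows "(mat_adjoint P *\<^sub>v w) \<bullet>c v = w \<bullet>c (P *\<^sub>v v)"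
proof -
  have "(mat_adjoint P *\<^sub>v w) \<bullet>c v = (\<Sum>i<k. \<Sum>j<n. conjugate (P $$ (j, i)) * w $ j * conjugate (v $ i))"
    using assms by (auto simp: cscalar_prod_sum[of v k] mult_mat_vec_index[of "mat_adjoint P" k n]
        sum_distrib_right simp del: index_mult_mat_vec intro!: sum.cong)
  also have "\<dots> = (\<Sum>j<n. \<Sum>i<k. conjugate (P $$ (j, i)) * w $ j * conjugate (v $ i))"
    by (rule sum.swap)
  also have "\<dots> = w \<bullet>c (P *\<^sub>v v)"
    using assms by (auto simp: cscalar_prod_sum[of "P *\<^sub>v v" n] mult_mat_vec_index
        sum_distrib_left sum_conjugate conjugate_dist_mul ac_simps simp del: index_mult_mat_vec intro!: sum.cong)
  finally show ?thesis .
qed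

text \<open>In this entrywise form the closure properties below become rearrangements of double
  sums. Test vectors are functions on \<open>nat\<close>, of which only the values below
  \<open>n\<close> enter.\<close>

lemma psd_mat_iff:
  fixes M :: "'k::conjugatable_ordered_field mat"
  shows "psd_mat n M \<longleftrightarrow> M \<in> carrier_mat n n \<and>
    (\<forall>i<n. \<forall>j<n. conjugate (M $$ (j, i)) = M $$ (i, j)) \<and>
    (\<forall>v. 0 \<le> (\<Sum>i<n. \<Sum>j<n. M $$ (i, j) * v j * conjugate (v i)))"
proof (cases "M \<in> carrier_mat n n")
  case M: True
  have "mat_adjoint M = M \<longleftrightarrow> (\<forall>i<n. \<forall>j<n. conjugate (M $$ (j, i)) = M $$ (i, j))"
    using M by (auto simp: mat_eq_iff)
  moreover have "(\<forall>v\<in>carrier_vec n. 0 \<le> (M *\<^sub>v v) \<bullet>c v) \<longleftrightarrow>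
      (\<forall>v. 0 \<le> (\<Sum>i<n. \<Sum>j<n. M $$ (i, j) * v j * conjugate (v i)))"
  proof (intro iffI allI ballI)
    fix v :: "nat \<Rightarrow> 'k"
    assume "\<forall>v\<in>carrier_vec n. 0 \<le> (M *\<^sub>v v) \<bullet>c v"
    then have "0 \<le> (M *\<^sub>v vec n v) \<bullet>c vec n v" by simp
    then show "0 \<le> (\<Sum>i<n. \<Sum>j<n. M $$ (i, j) * v j * conjugate (v i))"
      using M by (simp add: quadratic_form_sum)
  qed (use M in \<open>simp add: quadratic_form_sum\<close>)
  ultimately show ?thesis using M by (simp add: psd_mat_def)
qed (simp add: psd_mat_def)

lemma psd_matD:
  assumes "psd_mat n M"
  shows "M \<in> carrier_mat n n" "mat_adjoint M = M"
    "v \<in> carrier_vec n \<Longrightarrow> 0 \<le> (M *\<^sub>v v) \<bullet>c v"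
    "i < n \<Longrightarrow> j < n \<Longrightarrow> conjugate (M $$ (j, i)) = M $$ (i, j)"
  using assms psd_mat_iff[of n M] unfolding psd_mat_def by blast+

text \<open>Moving \<open>P\<close> across the inner product turns the form at \<open>v\<close> into
  the form of \<open>M\<close> at \<open>P *\<^sub>v v\<close>. A rectangular \<open>P\<close> is
  allowed because operators on Bob's space are later carried over to Alice's space.\<close>

lemma psd_mat_congruence:
  fixes M :: "'k::conjugatable_ordered_field mat"
  assumes M: "psd_mat n M" and P: "P \<in> carrier_mat n k"
  shows "psd_mat k (mat_adjoint P * M * P)"
proof -
  note Mc = psd_matD(1)[OF M]
  have P': "mat_adjoint P \<in> carrier_mat k n" using P by simp
  have c: "mat_adjoint P * M * P \<in> carrier_mat k k" using Mc P by auto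
  have PM: "mat_adjoint P * M \<in> carrier_mat k n" using P' Mc by simp
  have "mat_adjoint (mat_adjoint P * M * P) = mat_adjoint P * (M * P)"
    using mat_adjoint_mult[OF PM P] mat_adjoint_mult[OF P' Mc] psd_matD(2)[OF M] by simp
  also have "\<dots> = mat_adjoint P * M * P" using assoc_mult_mat[OF P' Mc P] by simp
  finally have "mat_adjoint (mat_adjoint P * M * P) = mat_adjoint P * M * P" .
  moreover have "\<forall>v\<in>carrier_vec k. 0 \<le> ((mat_adjoint P * M * P) *\<^sub>v v) \<bullet>c v"
  proof
    fix v :: "'k vec"
    assume v: "v \<in> carrier_vec k"
    have Pv: "P *\<^sub>v v \<in> carrier_vec n" using P v by simp
    have MPv: "M *\<^sub>v (P *\<^sub>v v) \<in> carrier_vec n" using Mc Pv by simp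
    have "(mat_adjoint P * M * P) *\<^sub>v v = mat_adjoint P *\<^sub>v (M *\<^sub>v (P *\<^sub>v v))"
      unfolding assoc_mult_mat_vec[OF PM P v] assoc_mult_mat_vec[OF P' Mc Pv] ..
    then have "((mat_adjoint P * M * P) *\<^sub>v v) \<bullet>c v = (M *\<^sub>v (P *\<^sub>v v)) \<bullet>c (P *\<^sub>v v)"
      by (simp only: adjoint_cscalar_prod[OF P MPv v])
    then show "0 \<le> ((mat_adjoint P * M * P) *\<^sub>v v) \<bullet>c v"
      using psd_matD(3)[OF M Pv] by (simp only:)
  qed
  ultimately show ?thesis
    unfolding psd_mat_def by (intro conjI c)
qed

text \<open>The form of the transpose at \<open>v\<close> is the form of \<open>M\<close> at the
  conjugate of \<open>v\<close>, with the two summations exchanged.\<close>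

lemma psd_mat_transpose:
  fixes M :: "'k::conjugatable_ordered_field mat"
  assumes "psd_mat n M"
  shows "psd_mat n (transpose_mat M)"
proof -
  have c: "M \<in> carrier_mat n n" using psd_matD[OF assms] by auto
  have "0 \<le> (\<Sum>i<n. \<Sum>j<n. M $$ (j, i) * v j * conjugate (v i))" for v :: "nat \<Rightarrow> 'k"
  proof -
    have "0 \<le> (\<Sum>i<n. \<Sum>j<n. M $$ (i, j) * conjugate (v j) * conjugate (conjugate (v i)))"
      using assms[unfolded psd_mat_iff] by (auto dest: spec[of _ "\<lambda>i. conjugate (v i)"])
    also have "\<dots> = (\<Sum>i<n. \<Sum>j<n. M $$ (j, i) * v j * conjugate (v i))"
      by (subst sum.swap) (simp add: ac_simps)
    finally show ?thesis .
  qed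
  then show ?thesis using c psd_matD(4)[OF assms] by (simp add: psd_mat_iff[of n "transpose_mat M"])
qed

lemma psd_mat_add:
  fixes M :: "'k::conjugatable_ordered_field mat"
  assumes "psd_mat n M" "psd_mat n L"
  shows "psd_mat n (M + L)"
proof -
  have "(\<Sum>i<n. \<Sum>j<n. (M + L) $$ (i, j) * v j * conjugate (v i)) =
      (\<Sum>i<n. \<Sum>j<n. M $$ (i, j) * v j * conjugate (v i)) +
      (\<Sum>i<n. \<Sum>j<n. L $$ (i, j) * v j * conjugate (v i))" for v :: "nat \<Rightarrow> 'k"
    using psd_matD(1)[OF assms(1)] psd_matD(1)[OF assms(2)]
    unfolding sum.distrib[symmetric] by (intro sum.cong refl) (auto simp: distrib_right)
  then show ?thesis
    using assms by (auto simp: psd_mat_iff conjugate_dist_add)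
qed

lemma psd_mat_mat_diag:
  fixes c :: "nat \<Rightarrow> real"
  assumes "\<And>i. i < n \<Longrightarrow> 0 \<le> c i"
  shows "psd_mat n (mat_diag n (\<lambda>i. complex_of_real (c i)))"
proof -
  have "(\<Sum>i<n. \<Sum>j<n. mat_diag n (\<lambda>i. complex_of_real (c i)) $$ (i, j) * v j * conjugate (v i)) =
      (\<Sum>i<n. complex_of_real (c i * (cmod (v i))\<^sup>2))" for v :: "nat \<Rightarrow> complex"
    by (intro sum.cong refl)
      (simp add: mat_diag_def if_distrib[of "\<lambda>z. z * _"] cong: if_cong flip: complex_norm_square)
  then show ?thesis
    unfolding psd_mat_iff by (auto simp: less_eq_complex_def assms simp del: of_real_mult of_real_power intro!: sum_nonneg) (auto simp: mat_diag_def)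
qed

lemma psd_mat_diag_nonneg:
  fixes M :: "complex mat"
  assumes "psd_mat n M" "i < n"
  shows "0 \<le> M $$ (i, i)"
proof -
  have u: "unit_vec n i \<in> carrier_vec n" by simp
  have "M *\<^sub>v unit_vec n i = col M i"
    using psd_matD(1)[OF assms(1)] assms(2) by (intro eq_vecI) auto
  moreover have "col M i \<bullet>c unit_vec n i = M $$ (i, i)"
    using psd_matD(1)[OF assms(1)] assms(2) by (simp add: cscalar_prod_sum[of _ n] unit_vec_def if_distrib cong: if_cong)
  ultimately show ?thesis using psd_matD(3)[OF assms(1) u] by simp
qed

section \<open>The spectral theorem\<close>

lemma mult_square_carrier:
  "A \<in> carrier_mat n n \<Longrightarrow> B \<in> carrier_mat n n \<Longrightarrow> A * B \<in> carrier_mat n n"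
  by simp

lemma mat_trace_mult:
  "A \<in> carrier_mat n m \<Longrightarrow> B \<in> carrier_mat m n \<Longrightarrow>
    mat_trace (A * B) = (\<Sum>i<n. \<Sum>j<m. A $$ (i, j) * B $$ (j, i))"
  by (simp add: mat_trace_def mult_mat_index[of A n m B n] del: index_mult_mat(1))

lemma mat_trace_comm:
  fixes A :: "'k::comm_semiring_0 mat"
  assumes "A \<in> carrier_mat n m" "B \<in> carrier_mat m n"
  shows "mat_trace (A * B) = mat_trace (B * A)"
  unfolding mat_trace_mult[OF assms] mat_trace_mult[OF assms(2,1)]
  by (subst sum.swap) (simp add: mult.commute)

lemma mat_sum_carrier [simp]: "mat_sum n F \<in> carrier_mat n n"
  by (simp add: mat_sum_def)

lemma mat_sum_dim [simp]: "dim_row (mat_sum n F) = n" "dim_col (mat_sum n F) = n"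
  by (simp_all add: mat_sum_def)

lemma index_mat_sum [simp]:
  "i < n \<Longrightarrow> j < n \<Longrightarrow> mat_sum n F $$ (i, j) = (\<Sum>a\<in>UNIV. F a $$ (i, j))"
  by (simp add: mat_sum_def)

lemma mat_sum_transpose:
  assumes "\<And>a. F a \<in> carrier_mat n n"
  shows "mat_sum n (\<lambda>a. transpose_mat (F a)) = transpose_mat (mat_sum n F)"
  by (rule eq_matI) (auto simp: carrier_matD[OF assms])

lemma index_triple_product:
  fixes A :: "'k::comm_semiring_0 mat"
  assumes A: "A \<in> carrier_mat n p" and B: "B \<in> carrier_mat p q" and C: "C \<in> carrier_mat q k"
    and ij: "i < n" "j < k"
  shows "(A * B * C) $$ (i, j) = (\<Sum>l<q. \<Sum>m<p. A $$ (i, m) * B $$ (m, l) * C $$ (l, j))"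
proof -
  have "(A * B * C) $$ (i, j) = (\<Sum>l<q. (A * B) $$ (i, l) * C $$ (l, j))"
    by (rule mult_mat_index[OF mult_carrier_mat[OF A B] C ij])
  also have "\<dots> = (\<Sum>l<q. \<Sum>m<p. A $$ (i, m) * B $$ (m, l) * C $$ (l, j))"
    using mult_mat_index[OF A B ij(1)]
    by (intro sum.cong refl) (simp add: sum_distrib_right del: index_mult_mat(1))
  finally show ?thesis .
qed

lemma mat_sum_congruence:
  fixes F :: "'i::finite \<Rightarrow> 'k::comm_semiring_0 mat"
  assumes "\<And>a. F a \<in> carrier_mat n n" "Q \<in> carrier_mat k n" "P \<in> carrier_mat n k"
  shows "mat_sum k (\<lambda>a. Q * F a * P) = Q * mat_sum n F * P"
proof (rule eq_matI)
  fix i j assume "i < dim_row (Q * mat_sum n F * P)" "j < dim_col (Q * mat_sum n F * P)"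
  then have ij: "i < k" "j < k" using assms by auto
  have c: "Q * F a \<in> carrier_mat k n" "Q * mat_sum n F \<in> carrier_mat k n" for a
    using assms by auto
  note triple = index_triple_product[OF assms(2) _ assms(3) ij]
  have "mat_sum k (\<lambda>a. Q * F a * P) $$ (i, j) =
      (\<Sum>a\<in>UNIV. \<Sum>l<n. \<Sum>m<n. Q $$ (i, m) * F a $$ (m, l) * P $$ (l, j))"
    using ij triple[OF assms(1)] by (simp del: index_mult_mat(1))
  also have "\<dots> = (\<Sum>l<n. \<Sum>m<n. \<Sum>a\<in>UNIV. Q $$ (i, m) * F a $$ (m, l) * P $$ (l, j))"
    by (subst sum.swap) (intro sum.cong refl sum.swap)
  also have "\<dots> = (Q * mat_sum n F * P) $$ (i, j)"
    unfolding triple[OF mat_sum_carrier]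
    by (intro sum.cong refl) (simp add: sum_distrib_left sum_distrib_right)
  finally show "mat_sum k (\<lambda>a. Q * F a * P) $$ (i, j) = (Q * mat_sum n F * P) $$ (i, j)" .
qed (use assms in auto)

lemma mat_trace_mat_sum:
  fixes F :: "'i::finite \<Rightarrow> 'k::comm_semiring_0 mat" and G :: "'j::finite \<Rightarrow> 'k mat"
  assumes "\<And>a. F a \<in> carrier_mat n n" "\<And>b. G b \<in> carrier_mat n n"
  shows "(\<Sum>a\<in>UNIV. \<Sum>b\<in>UNIV. mat_trace (F a * G b)) = mat_trace (mat_sum n F * mat_sum n G)"
proof -
  have "(\<Sum>a\<in>UNIV. \<Sum>b\<in>UNIV. mat_trace (F a * G b)) =
      (\<Sum>a\<in>UNIV. \<Sum>b\<in>UNIV. \<Sum>i<n. \<Sum>j<n. F a $$ (i, j) * G b $$ (j, i))"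
    using assms by (simp add: mat_trace_mult[of _ n n])
  also have "\<dots> = (\<Sum>i<n. \<Sum>j<n. \<Sum>a\<in>UNIV. \<Sum>b\<in>UNIV. F a $$ (i, j) * G b $$ (j, i))"
    by (simp only: sum.swap[of _ "{..<n}" UNIV])
  also have "\<dots> = mat_trace (mat_sum n F * mat_sum n G)"
    by (simp add: mat_trace_mult[of _ n n] sum_product)
  finally show ?thesis .
qed

section \<open>Unitary diagonalisation of Hermitian matrices\<close>

lemma unitary_first_column_eigenvector:
  fixes A :: "complex mat"
  assumes A: "A \<in> carrier_mat n n" and n: "n > 0"
  obtains U e where "U \<in> carrier_mat n n" "mat_adjoint U * U = 1\<^sub>m n"
    "\<And>i. i < n \<Longrightarrow> (mat_adjoint U * (A * U)) $$ (i, 0) = (if i = 0 then e else 0)"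
proof -
  \<comment> \<open>An eigenvector, completed to an orthonormal basis, becomes the first column of
    \<open>U\<close>. The other columns are orthogonal to it, which clears the rest of column 0
    after conjugation.\<close>
  from spectrum_non_empty[OF A n] obtain e v where "eigenvector A v e"
    by (auto simp: spectrum_def eigenvalue_def)
  then have v: "v \<in> carrier_vec n" "v \<noteq> 0\<^sub>v n" and ev: "A *\<^sub>v v = e \<cdot>\<^sub>v v"
    using A by (auto simp: eigenvector_def)
  interpret cof_vec_space n "TYPE(complex)" .
  define ws where "ws = gram_schmidt n (basis_completion v)"
  note bc = basis_completion[OF v]
  from gram_schmidt_result[OF bc(2,4,5) ws_def]
  have ws: "set ws \<subseteq> carrier_vec n" "corthogonal ws" "length ws = n"
    using bc(6) by auto
  from bc(7) bc(6) n obtain vs where "basis_completion v = v # vs"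
    by (cases "basis_completion v") auto
  \<comment> \<open>Gram-Schmidt leaves the head vector unchanged, so the eigenvector stays in
    position 0.\<close>
  then have "hd ws = v" using gram_schmidt_hd[OF v(1), of vs] by (simp add: ws_def)
  then have ws0: "ws ! 0 = v" using ws(3) n by (cases ws) auto
  have wsc: "ws ! j \<in> carrier_vec n" if "j < n" for j using ws that by auto
  \<comment> \<open>The vectors in \<open>ws\<close> are orthogonal but not normalised;
    \<open>r j\<close> is the norm of the vector at position \<open>j\<close>, taken as a complex
    number so that it can divide the entries.\<close>
  define r where "r j = complex_of_real (sqrt (Re (ws ! j \<bullet>c ws ! j)))" for j
  have r: "r j * r j = ws ! j \<bullet>c ws ! j" "r j \<noteq> 0" "cnj (r j) = r j" if "j < n" for j
  proof -
    have "ws ! j \<bullet>c ws ! j \<noteq> 0" using corthogonalD[OF ws(2), of j j] that ws(3) by simp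
    moreover have "ws ! j \<bullet>c ws ! j \<ge> 0"
      by (simp add: conjugate_square_positive cscalar_prod_sum[OF refl] sum_nonneg del: conjugate_complex_def)
    ultimately have "Re (ws ! j \<bullet>c ws ! j) > 0" "ws ! j \<bullet>c ws ! j = complex_of_real (Re (ws ! j \<bullet>c ws ! j))"
      by (auto simp: less_eq_complex_def complex_eq_iff)
    then show "r j * r j = ws ! j \<bullet>c ws ! j" "r j \<noteq> 0" "cnj (r j) = r j"
      unfolding r_def by (auto simp flip: of_real_mult)
  qed
  define U where "U = mat n n (\<lambda>(i, j). ws ! j $ i / r j)"
  have U: "U \<in> carrier_mat n n" by (simp add: U_def)
  have UU: "(mat_adjoint U * U) $$ (i, j) = (if i = j then 1 else 0)" if "i < n" "j < n" for i j
  proof -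
    have "(mat_adjoint U * U) $$ (i, j) = (\<Sum>k<n. ws ! j $ k * cnj (ws ! i $ k) / (r i * r j))"
      using that r(3)[OF that(1)] mult_mat_index[of "mat_adjoint U" n n U n i j] U
      by (auto simp: U_def mult.commute simp del: index_mult_mat(1) intro!: sum.cong)
    also have "\<dots> = (ws ! j \<bullet>c ws ! i) / (r i * r j)"
      using that wsc[of i] by (simp add: cscalar_prod_sum[of _ n] sum_divide_distrib)
    also have "\<dots> = (if i = j then 1 else 0)"
      using corthogonalD[OF ws(2), of j i] that ws(3) r(1)[of i] r(2) by auto
    finally show ?thesis .
  qed
  have AU: "(A * U) $$ (k, 0) = e * U $$ (k, 0)" if "k < n" for k
  proof -
    have "(A * U) $$ (k, 0) = (A *\<^sub>v v) $ k / r 0"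
      using that n A v U ws0
      by (simp add: mult_mat_index[of A n n U n] mult_mat_vec_index[of A n n] sum_divide_distrib
          del: index_mult_mat index_mult_mat_vec) (simp add: U_def ws0)
    then show ?thesis using that n v by (simp add: ev U_def ws0 del: index_mult_mat_vec)
  qed
  have "(mat_adjoint U * (A * U)) $$ (i, 0) = (if i = 0 then e else 0)" if "i < n" for i
  proof -
    have "(mat_adjoint U * (A * U)) $$ (i, 0) = e * (mat_adjoint U * U) $$ (i, 0)"
      using that n A U AU
      by (auto simp: mult_mat_index[of "mat_adjoint U" n n _ n] sum_distrib_left ac_simps
          simp del: index_mult_mat(1) intro!: sum.cong)
    then show ?thesis using UU[OF that n] by simp
  qed
  moreover have "mat_adjoint U * U = 1\<^sub>m n"
    using U UU by (intro eq_matI) (auto simp del: index_mult_mat(1))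
  ultimately show ?thesis using that U by blast
qed

text \<open>Deflation: conjugating by a unitary with an eigenvector in front splits off a 1 by 1
  block, and the remaining block is again Hermitian and one size smaller.\<close>

lemma hermitian_diagonalization:
  fixes A :: "complex mat"
  assumes "A \<in> carrier_mat n n" "mat_adjoint A = A"
  obtains U d where "U \<in> carrier_mat n n" "mat_adjoint U * U = 1\<^sub>m n"
    "mat_adjoint U * A * U = mat_diag n d"
  using assms
proof (induction n arbitrary: A thesis)
  case 0
  show ?case by (rule "0.prems"(1)[of "1\<^sub>m 0"]) (auto simp: mat_diag_def)
next
  case (Suc m)
  let ?n = "Suc m"
  note A = Suc.prems(2)
  obtain W e where W: "W \<in> carrier_mat ?n ?n" "mat_adjoint W * W = 1\<^sub>m ?n"
    and col0: "\<And>i. i < ?n \<Longrightarrow> (mat_adjoint W * (A * W)) $$ (i, 0) = (if i = 0 then e else 0)"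
    using unitary_first_column_eigenvector[OF A] by blast
  have W': "mat_adjoint W \<in> carrier_mat ?n ?n" using W by simp
  define B where "B = mat_adjoint W * (A * W)"
  have B: "B \<in> carrier_mat ?n ?n" using A W W' by (simp add: B_def mult_square_carrier)
  have Badj: "mat_adjoint B = B"
    unfolding B_def using A W W' Suc.prems(3)
    by (simp add: mat_adjoint_mult[of _ ?n ?n _ ?n] assoc_mult_mat[of _ ?n ?n _ ?n _ ?n] mult_square_carrier)
  \<comment> \<open>Since \<open>B\<close> is Hermitian, the zeros below the corner in column 0
    reappear in row 0.\<close>
  have row0: "B $$ (0, j) = (if j = 0 then e else 0)" if "j < ?n" for j
  proof -
    have "B $$ (0, j) = cnj (B $$ (j, 0))"
      using index_mat_adjoint[of 0 B j] that B Badj by auto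
    then show ?thesis using col0[OF that] col0[of 0] that index_mat_adjoint[of 0 B 0] B Badj
      by (auto simp: B_def[symmetric])
  qed
  define C where "C = mat m m (\<lambda>(i, j). B $$ (Suc i, Suc j))"
  have C: "C \<in> carrier_mat m m" by (simp add: C_def)
  have "mat_adjoint C = C"
  proof (rule eq_matI)
    fix i j assume "i < dim_row C" "j < dim_col C"
    then show "mat_adjoint C $$ (i, j) = C $$ (i, j)"
      using index_mat_adjoint[of "Suc i" B "Suc j"] B Badj by (auto simp: C_def)
  qed (simp_all add: C_def)
  then obtain V d where V: "V \<in> carrier_mat m m" "mat_adjoint V * V = 1\<^sub>m m"
    and VCV: "mat_adjoint V * C * V = mat_diag m d"
    using Suc.IH[OF _ C] by blast
  have V': "mat_adjoint V \<in> carrier_mat m m" using V by simp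
  \<comment> \<open>\<open>F\<close> lets the unitary of the smaller block act while fixing the
    first basis vector, so \<open>W * F\<close> diagonalises \<open>A\<close>.\<close>
  define F where "F = four_block_mat (1\<^sub>m 1) (0\<^sub>m 1 m) (0\<^sub>m m 1) V"
  have F: "F \<in> carrier_mat ?n ?n" using V by (intro carrier_matI) (auto simp: F_def)
  have F': "mat_adjoint F \<in> carrier_mat ?n ?n" using F by simp
  have Fadj: "mat_adjoint F = four_block_mat (1\<^sub>m 1) (0\<^sub>m 1 m) (0\<^sub>m m 1) (mat_adjoint V)"
    using V by (intro eq_matI) (auto simp: F_def)
  have Bblock: "B = four_block_mat (mat 1 1 (\<lambda>_. e)) (0\<^sub>m 1 m) (0\<^sub>m m 1) C"
  proof (rule eq_matI)
    fix i j
    assume "i < dim_row (four_block_mat (mat 1 1 (\<lambda>_. e)) (0\<^sub>m 1 m) (0\<^sub>m m 1) C)"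
      "j < dim_col (four_block_mat (mat 1 1 (\<lambda>_. e)) (0\<^sub>m 1 m) (0\<^sub>m m 1) C)"
    then have "i < ?n" "j < ?n" by (auto simp: C_def)
    then show "B $$ (i, j) = four_block_mat (mat 1 1 (\<lambda>_. e)) (0\<^sub>m 1 m) (0\<^sub>m m 1) C $$ (i, j)"
      using row0[of j] col0[of i] by (cases i; cases j) (auto simp: C_def B_def[symmetric])
  qed (use B in \<open>auto simp: C_def\<close>)
  have FF: "mat_adjoint F * F = 1\<^sub>m ?n"
    unfolding Fadj unfolding F_def
    by (subst mult_four_block_mat[of _ 1 1 _ m _ m _ _ 1 _ m]) (use V V' in auto)
  have FBF: "mat_adjoint F * B * F = mat_diag ?n (case_nat e d)"
  proof -
    have "mat_adjoint F * B = four_block_mat (mat 1 1 (\<lambda>_. e)) (0\<^sub>m 1 m) (0\<^sub>m m 1) (mat_adjoint V * C)"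
      unfolding Fadj Bblock
      by (subst mult_four_block_mat[of _ 1 1 _ m _ m _ _ 1 _ m]) (use V V' C in auto)
    then have "mat_adjoint F * B * F = four_block_mat (mat 1 1 (\<lambda>_. e)) (0\<^sub>m 1 m) (0\<^sub>m m 1) (mat_diag m d)"
      unfolding F_def VCV[symmetric]
      by (simp only:, subst mult_four_block_mat[of _ 1 1 _ m _ m _ _ 1 _ m]) (use V V' C in auto)
    also have "\<dots> = mat_diag ?n (case_nat e d)"
      by (rule eq_matI) (auto simp: mat_diag_def split: nat.split)
    finally show ?thesis .
  qed
  have "mat_adjoint (W * F) = mat_adjoint F * mat_adjoint W"
    using mat_adjoint_mult[OF W(1) F] .
  moreover have "mat_adjoint F * mat_adjoint W * (W * F) = mat_adjoint F * (mat_adjoint W * W * F)"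
    using assoc_mult_mat[OF F' W', of "W * F" ?n] assoc_mult_mat[OF W' W(1) F] W F by auto
  moreover have "mat_adjoint F * mat_adjoint W * A * (W * F) = mat_adjoint F * B * F"
    unfolding B_def using F F' W(1) W' A
    by (simp add: assoc_mult_mat[of _ ?n ?n _ ?n _ ?n] mult_square_carrier)
  ultimately show ?case
    using Suc.prems(1)[of "W * F" "case_nat e d"] W F FF FBF by simp
qed

lemma psd_mat_diagonalization:
  fixes W :: "complex mat"
  assumes W: "psd_mat n W"
  obtains U l where "U \<in> carrier_mat n n" "mat_adjoint U * U = 1\<^sub>m n"
    "\<And>i. i < n \<Longrightarrow> 0 \<le> l i" "mat_adjoint U * W * U = mat_diag n (\<lambda>i. complex_of_real (l i))"
proof -
  obtain U d where U: "U \<in> carrier_mat n n" "mat_adjoint U * U = 1\<^sub>m n"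
    and d: "mat_adjoint U * W * U = mat_diag n d"
    using hermitian_diagonalization[OF psd_matD(1,2)[OF W]] by blast
  have "0 \<le> d i" if "i < n" for i
    using psd_mat_diag_nonneg[OF psd_mat_congruence[OF W U(1)] that] that by (simp add: d mat_diag_def)
  then have r: "d i = complex_of_real (Re (d i))" "0 \<le> Re (d i)" if "i < n" for i
    using that by (auto simp: less_eq_complex_def complex_eq_iff)
  have "mat_diag n d = mat_diag n (\<lambda>i. complex_of_real (Re (d i)))"
    by (rule eq_matI) (auto simp: mat_diag_def r(1)[symmetric])
  with U d r(2) show ?thesis by (intro that[of U "\<lambda>i. Re (d i)"]) auto
qed

section \<open>Positivity of traces and vanishing rows\<close>

lemma mat_trace_unitary_conjugation:
  fixes U :: "complex mat"
  assumes U: "U \<in> carrier_mat n n" "mat_adjoint U * U = 1\<^sub>m n"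
    and M: "M \<in> carrier_mat n n" and N: "N \<in> carrier_mat n n"
  shows "mat_trace ((mat_adjoint U * M * U) * (mat_adjoint U * N * U)) = mat_trace (M * N)"
proof -
  have U': "mat_adjoint U \<in> carrier_mat n n" using U by simp
  \<comment> \<open>A one-sided inverse of a square matrix is two-sided, so the inner product of
    \<open>U\<close> with its adjoint cancels as well as the outer one.\<close>
  have UU': "U * mat_adjoint U = 1\<^sub>m n" by (rule mat_mult_left_right_inverse[OF U' U])
  have "(mat_adjoint U * M * U) * (mat_adjoint U * N * U) = mat_adjoint U * M * (U * mat_adjoint U) * (N * U)"
    using U(1) U' M N by (simp add: assoc_mult_mat[of _ n n _ n _ n] mult_square_carrier)
  also have "\<dots> = mat_adjoint U * (M * N * U)"
    unfolding UU' using U(1) U' M N by (simp add: assoc_mult_mat[of _ n n _ n _ n] mult_square_carrier)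
  also have "mat_trace \<dots> = mat_trace (M * N * U * mat_adjoint U)"
    using U(1) U' M N by (intro mat_trace_comm[of _ n n]) auto
  also have "M * N * U * mat_adjoint U = M * N * (U * mat_adjoint U)"
    using U(1) U' M N by (simp add: assoc_mult_mat[of _ n n _ n _ n] mult_square_carrier)
  finally show ?thesis unfolding UU' using M N by simp
qed

text \<open>Diagonalising \<open>M\<close> alone suffices: the trace then pairs the eigenvalues of
  \<open>M\<close> with the diagonal entries of the conjugated \<open>N\<close>, and both are
  nonnegative.\<close>

lemma mat_trace_psd_nonneg:
  fixes M N :: "complex mat"
  assumes M: "psd_mat n M" and N: "psd_mat n N"
  shows "0 \<le> mat_trace (M * N)"
proof -
  obtain U l where U: "U \<in> carrier_mat n n" "mat_adjoint U * U = 1\<^sub>m n"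
    and l: "\<And>i. i < n \<Longrightarrow> 0 \<le> l i" "mat_adjoint U * M * U = mat_diag n (\<lambda>i. complex_of_real (l i))"
    using psd_mat_diagonalization[OF M] by blast
  define N' where "N' = mat_adjoint U * N * U"
  have N': "psd_mat n N'" unfolding N'_def by (rule psd_mat_congruence[OF N U(1)])
  have "mat_trace (M * N) = mat_trace (mat_diag n (\<lambda>i. complex_of_real (l i)) * N')"
    using mat_trace_unitary_conjugation[OF U psd_matD(1)[OF M] psd_matD(1)[OF N]]
    by (simp only: l(2) N'_def)
  also have "\<dots> = (\<Sum>i<n. complex_of_real (l i) * N' $$ (i, i))"
    unfolding mat_diag_mult_left[OF psd_matD(1)[OF N']] by (simp add: mat_trace_def)
  also have "\<dots> \<ge> 0"
    using l(1) psd_mat_diag_nonneg[OF N'] by (intro sum_nonneg) (auto simp: less_eq_complex_def)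
  finally show ?thesis .
qed

lemma sum_mult_of_bool:
  fixes f :: "nat \<Rightarrow> 'k::semiring_1"
  shows "j < n \<Longrightarrow> (\<Sum>l<n. f l * of_bool (l = j)) = f j"
  by (simp add: of_bool_def if_distrib cong: if_cong)

text \<open>If the entry were nonzero, the form at \<open>e_j + z e_i\<close> would be affine in
  \<open>z\<close>, because the quadratic term in \<open>z\<close> has coefficient
  \<open>M $$ (i, i) = 0\<close>, and hence could be made negative.\<close>

lemma psd_mat_zero_diag:
  fixes M :: "complex mat"
  assumes M: "psd_mat n M" and ij: "i < n" "j < n" and zero: "M $$ (i, i) = 0"
  shows "M $$ (i, j) = 0"
proof (rule ccontr)
  assume nz: "M $$ (i, j) \<noteq> 0"
  define m where "m = M $$ (i, j)"
  define c where "c = Re (M $$ (j, j))"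
  have c: "M $$ (j, j) = complex_of_real c"
    using psd_mat_diag_nonneg[OF M ij(2)] by (auto simp: c_def less_eq_complex_def complex_eq_iff)
  have ji: "M $$ (j, i) = cnj m" using psd_matD(4)[OF M ij(2,1)] by (simp add: m_def)
  \<comment> \<open>With this \<open>z\<close> each of the two cross terms equals
    \<open>- (c + 1) / 2\<close>, so the form takes the value
    \<open>c - (c + 1) = - 1\<close>.\<close>
  define z where "z = - complex_of_real ((c + 1) / (2 * (cmod m)\<^sup>2)) * m"
  define v where "v k = of_bool (k = j) + z * of_bool (k = i)" for k
  have inner: "(\<Sum>l<n. M $$ (k, l) * v l) = M $$ (k, j) + z * M $$ (k, i)" for k
  proof -
    have "M $$ (k, l) * v l = M $$ (k, l) * of_bool (l = j) + z * M $$ (k, l) * of_bool (l = i)" for l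
      by (simp add: v_def algebra_simps)
    then show ?thesis using ij by (simp add: sum.distrib sum_mult_of_bool)
  qed
  have outer: "(\<Sum>k<n. f k * cnj (v k)) = f j + cnj z * f i" for f
  proof -
    have "f k * cnj (v k) = f k * of_bool (k = j) + cnj z * f k * of_bool (k = i)" for k
      by (simp add: v_def algebra_simps)
    then show ?thesis using ij by (simp add: sum.distrib sum_mult_of_bool)
  qed
  have "(\<Sum>k<n. \<Sum>l<n. M $$ (k, l) * v l * conjugate (v k)) =
      (\<Sum>k<n. (M $$ (k, j) + z * M $$ (k, i)) * cnj (v k))"
    by (simp add: inner flip: sum_distrib_right)
  also have "\<dots> = (M $$ (j, j) + z * M $$ (j, i)) + cnj z * (M $$ (i, j) + z * M $$ (i, i))"
    by (rule outer)
  also have "\<dots> = complex_of_real c + z * cnj m + cnj z * m"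
    by (simp add: zero c ji flip: m_def)
  also have "z * cnj m = - complex_of_real ((c + 1) / (2 * (cmod m)\<^sup>2) * (cmod m)\<^sup>2)"
    unfolding z_def by (simp only: mult.assoc of_real_mult complex_norm_square mult_minus_left)
  also have "cnj z * m = - complex_of_real ((c + 1) / (2 * (cmod m)\<^sup>2) * (cmod m)\<^sup>2)"
    unfolding z_def
    by (simp only: mult.assoc of_real_mult complex_norm_square mult_minus_left complex_cnj_minus
        complex_cnj_mult complex_cnj_complex_of_real mult.commute[of "cnj m" m])
  also have "(c + 1) / (2 * (cmod m)\<^sup>2) * (cmod m)\<^sup>2 = (c + 1) / 2"
    using nz by (simp add: m_def)
  finally have "(\<Sum>k<n. \<Sum>l<n. M $$ (k, l) * v l * conjugate (v k)) = - 1"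
    by (simp add: complex_eq_iff field_simps)
  moreover have "0 \<le> (\<Sum>k<n. \<Sum>l<n. M $$ (k, l) * v l * conjugate (v k))"
    using M by (simp only: psd_mat_iff)
  ultimately show False by (simp add: less_eq_complex_def)
qed

text \<open>The nonnegative diagonal entries at \<open>i\<close> sum to zero, so each is zero and
  takes its row and column with it. This is what makes division by the square roots of a singular
  diagonal matrix harmless.\<close>

lemma psd_family_zero:
  fixes F :: "'i::finite \<Rightarrow> complex mat"
  assumes F: "\<And>b. psd_mat n (F b)" and sum: "mat_sum n F = mat_diag n d"
    and ij: "i < n" "j < n" and zero: "d i = 0"
  shows "F b $$ (i, j) = 0" "F b $$ (j, i) = 0"
proof -
  have "(\<Sum>b\<in>UNIV. F b $$ (i, i)) = 0"
    using index_mat_sum[OF ij(1) ij(1), of F] zero ij by (simp add: sum mat_diag_def)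
  then have "F b $$ (i, i) = 0"
    using psd_mat_diag_nonneg[OF F ij(1)] by (subst (asm) sum_nonneg_eq_0_iff) auto
  then show "F b $$ (i, j) = 0" by (rule psd_mat_zero_diag[OF F ij])
  then show "F b $$ (j, i) = 0" using psd_matD(4)[OF F ij(2,1), of b] by simp
qed

lemma psd_mat_sum:
  fixes F :: "'i::finite \<Rightarrow> 'k::conjugatable_ordered_field mat"
  assumes F: "\<And>b. psd_mat n (F b)"
  shows "psd_mat n (mat_sum n F)"
proof -
  have "(\<Sum>i<n. \<Sum>j<n. mat_sum n F $$ (i, j) * v j * conjugate (v i)) =
      (\<Sum>b\<in>UNIV. \<Sum>i<n. \<Sum>j<n. F b $$ (i, j) * v j * conjugate (v i))" for v :: "nat \<Rightarrow> 'k"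
    by (simp add: sum_distrib_right sum.swap[of _ "{..<n}" UNIV])
  moreover have "0 \<le> (\<Sum>b\<in>UNIV. \<Sum>i<n. \<Sum>j<n. F b $$ (i, j) * v j * conjugate (v i))" for v :: "nat \<Rightarrow> 'k"
    by (rule sum_nonneg) (use F in \<open>simp add: psd_mat_iff\<close>)
  ultimately show ?thesis
    using psd_matD(4)[OF F] by (simp add: psd_mat_iff[of n "mat_sum n F"] sum_conjugate)
qed

section \<open>Balanced form of a quantum correlation\<close>

text \<open>Zeros in \<open>l\<close> are allowed, so a given strategy or Gram representation keeps
  its dimension; the kernel of the diagonal matrix is treated separately where inverses
  occur.\<close>

definition balanced_form ::
  "nat \<Rightarrow> (nat \<Rightarrow> real) \<Rightarrow> ('s::finite \<Rightarrow> 'a::finite \<Rightarrow> complex mat) \<Rightarrow>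
    ('t::finite \<Rightarrow> 'b::finite \<Rightarrow> complex mat) \<Rightarrow> bool" where
  "balanced_form n l M N \<longleftrightarrow> (\<forall>i<n. 0 \<le> l i) \<and> (\<Sum>i<n. (l i)\<^sup>2) = 1 \<and>
     (\<forall>s a. psd_mat n (M s a)) \<and> (\<forall>t b. psd_mat n (N t b)) \<and>
     (\<forall>s. mat_sum n (M s) = mat_diag n (\<lambda>i. complex_of_real (l i))) \<and>
     (\<forall>t. mat_sum n (N t) = mat_diag n (\<lambda>i. complex_of_real (l i)))"

text \<open>By bilinearity the double sum is the trace of the squared diagonal matrix. It serves
  both as total probability of a question pair and as block sum of a Gram matrix.\<close>

lemma sum_trace_diag:
  fixes F :: "'i::finite \<Rightarrow> complex mat" and G :: "'j::finite \<Rightarrow> complex mat"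
  assumes "\<And>a. F a \<in> carrier_mat n n" "\<And>b. G b \<in> carrier_mat n n"
    and "mat_sum n F = mat_diag n (\<lambda>i. complex_of_real (l i))"
    and "mat_sum n G = mat_diag n (\<lambda>i. complex_of_real (l i))"
  shows "(\<Sum>a\<in>UNIV. \<Sum>b\<in>UNIV. Re (mat_trace (F a * G b))) = (\<Sum>i<n. (l i)\<^sup>2)"
proof -
  have "(\<Sum>a\<in>UNIV. \<Sum>b\<in>UNIV. Re (mat_trace (F a * G b))) =
      Re (\<Sum>a\<in>UNIV. \<Sum>b\<in>UNIV. mat_trace (F a * G b))"
    by simp
  also have "\<dots> = (\<Sum>i<n. (l i)\<^sup>2)"
    unfolding mat_trace_mat_sum[OF assms(1,2)] assms(3,4) mat_diag_diag
    by (simp add: mat_trace_def mat_diag_def power2_eq_square)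
  finally show ?thesis .
qed

section \<open>Bipartite vectors as matrices\<close>

lemma sum_lessThan_prod:
  fixes f :: "nat \<Rightarrow> 'k::comm_monoid_add"
  shows "(\<Sum>k<n * m. f k) = (\<Sum>i<n. \<Sum>j<m. f (i * m + j))"
proof -
  have "sum f {i * m..<i * m + m} = (\<Sum>j<m. f (i * m + j))" for i
    using sum.shift_bounds_nat_ivl[of f 0 "i * m" m] by (simp add: atLeast0LessThan add.commute)
  then show ?thesis by (simp flip: sum.nat_group)
qed

lemma index_lessThan_prod:
  fixes i j n m :: nat
  assumes "i < n" "j < m"
  shows "i * m + j < n * m"
proof -
  have "i * m + j < Suc i * m" using assms by simp
  also have "\<dots> \<le> n * m" using assms by (intro mult_le_mono1) simp
  finally show ?thesis .
qed

lemma tensor_quadratic_form: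
  fixes \<psi> :: "complex vec"
  assumes X: "X \<in> carrier_mat n n" and Y: "Y \<in> carrier_mat m m" and \<psi>: "\<psi> \<in> carrier_vec (n * m)"
  shows "(tensor_mat X Y *\<^sub>v \<psi>) \<bullet>c \<psi> =
    (\<Sum>i<n. \<Sum>j<m. \<Sum>i'<n. \<Sum>j'<m.
      X $$ (i, i') * Y $$ (j, j') * \<psi> $ (i' * m + j') * cnj (\<psi> $ (i * m + j)))"
proof -
  have "tensor_mat X Y \<in> carrier_mat (n * m) (n * m)"
    using X Y by (auto simp: tensor_mat_def)
  then have "(tensor_mat X Y *\<^sub>v \<psi>) \<bullet>c \<psi> =
      (\<Sum>k<n * m. \<Sum>l<n * m. tensor_mat X Y $$ (k, l) * \<psi> $ l * conjugate (\<psi> $ k))"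
    by (rule quadratic_form_sum[OF _ \<psi>])
  also have "\<dots> = (\<Sum>i<n. \<Sum>j<m. \<Sum>i'<n. \<Sum>j'<m.
      X $$ (i, i') * Y $$ (j, j') * \<psi> $ (i' * m + j') * cnj (\<psi> $ (i * m + j)))"
    unfolding sum_lessThan_prod
    using X Y by (intro sum.cong refl) (simp add: tensor_mat_def index_lessThan_prod)
  finally show ?thesis .
qed

text \<open>Reshaping the vector into a matrix moves Bob's operator onto Alice's space, so only one
  space remains. The transpose appears because Bob's index is the column index of
  \<open>\<Psi>\<close>.\<close>

lemma trace_tensor_identity:
  fixes \<psi> :: "complex vec"
  assumes X: "X \<in> carrier_mat n n" and Y: "Y \<in> carrier_mat m m" and \<psi>: "\<psi> \<in> carrier_vec (n * m)"
  defines "\<Psi> \<equiv> mat n m (\<lambda>(i, j). \<psi> $ (i * m + j))"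
  shows "(tensor_mat X Y *\<^sub>v \<psi>) \<bullet>c \<psi> = mat_trace (X * (\<Psi> * transpose_mat Y * mat_adjoint \<Psi>))"
proof -
  have \<Psi>: "\<Psi> \<in> carrier_mat n m" "mat_adjoint \<Psi> \<in> carrier_mat m n" by (simp_all add: \<Psi>_def)
  have Y': "transpose_mat Y \<in> carrier_mat m m" using Y by simp
  note c = mult_carrier_mat[OF mult_carrier_mat[OF \<Psi>(1) Y'] \<Psi>(2)]
  have "mat_trace (X * (\<Psi> * transpose_mat Y * mat_adjoint \<Psi>)) =
      (\<Sum>i<n. \<Sum>i'<n. X $$ (i, i') * (\<Sum>j<m. \<Sum>j'<m. \<psi> $ (i' * m + j') * Y $$ (j, j') * cnj (\<psi> $ (i * m + j))))"
    unfolding mat_trace_mult[OF X c]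
    using Y by (intro sum.cong refl, subst index_triple_product[OF \<Psi>(1) Y' \<Psi>(2)]) (auto simp: \<Psi>_def intro!: sum.cong)
  also have "\<dots> = (\<Sum>i<n. \<Sum>i'<n. \<Sum>j<m. \<Sum>j'<m.
      X $$ (i, i') * Y $$ (j, j') * \<psi> $ (i' * m + j') * cnj (\<psi> $ (i * m + j)))"
    by (simp add: sum_distrib_left ac_simps)
  also have "\<dots> = (tensor_mat X Y *\<^sub>v \<psi>) \<bullet>c \<psi>"
    unfolding tensor_quadratic_form[OF X Y \<psi>] by (intro sum.cong refl sum.swap)
  finally show ?thesis ..
qed

section \<open>Rescaling by diagonal matrices\<close>

lemma mat_adjoint_mat_diag_real [simp]:
  "mat_adjoint (mat_diag n (\<lambda>i. complex_of_real (c i))) = mat_diag n (\<lambda>i. complex_of_real (c i))"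
  by (rule eq_matI) (auto simp: mat_diag_def)

lemma diag_sandwich_index:
  fixes A :: "'k::comm_ring_1 mat"
  assumes A: "A \<in> carrier_mat n n" and "i < n" "j < n"
  shows "(mat_diag n c * A * mat_diag n c) $$ (i, j) = c i * A $$ (i, j) * c j"
proof -
  have "mat_diag n c * A \<in> carrier_mat n n" using A by (intro mult_square_carrier) simp_all
  then show ?thesis
    using assms by (subst mat_diag_mult_right[of _ n n]) (auto simp: mat_diag_mult_left[OF A])
qed

lemma psd_diag_sandwich:
  fixes c :: "nat \<Rightarrow> real"
  assumes "psd_mat n A"
  shows "psd_mat n (mat_diag n (\<lambda>i. complex_of_real (c i)) * A * mat_diag n (\<lambda>i. complex_of_real (c i)))"
  using psd_mat_congruence[OF assms mat_diag_dim[of n "\<lambda>i. complex_of_real (c i)"]] by simp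

lemma mat_sum_diag_sandwich:
  fixes F :: "'i::finite \<Rightarrow> complex mat"
  assumes "\<And>a. F a \<in> carrier_mat n n" "mat_sum n F = mat_diag n d"
  shows "mat_sum n (\<lambda>a. mat_diag n c * F a * mat_diag n c) = mat_diag n (\<lambda>i. c i * d i * c i)"
  by (simp add: mat_sum_congruence[OF assms(1) mat_diag_dim mat_diag_dim] assms(2))

lemma mat_diag_cong: "(\<And>i. i < n \<Longrightarrow> f i = g i) \<Longrightarrow> mat_diag n f = mat_diag n g"
  by (rule eq_matI) (auto simp: mat_diag_def)

section \<open>From strategies to balanced forms and back\<close>

lemma quantum_imp_balanced_form:
  fixes p :: "('a::finite, 'b::finite, 's::finite, 't::finite) correlation"
  assumes "p \<in> quantum_correlations"
  obtains n l M N where "balanced_form n l M N"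
    "\<And>a b s t. p a b s t = Re (mat_trace (M s a * N t b))"
proof -
  obtain n m \<psi> X Y where p: "p \<in> unrestricted_correlations"
    and \<psi>: "\<psi> \<in> carrier_vec (n * m)"
    and X: "\<And>s a. psd_mat n (X s a)" "\<And>s. mat_sum n (X s) = 1\<^sub>m n"
    and Y: "\<And>t b. psd_mat m (Y t b)" "\<And>t. mat_sum m (Y t) = 1\<^sub>m m"
    and pe: "\<And>a b s t. complex_of_real (p a b s t) = (tensor_mat (X s a) (Y t b) *\<^sub>v \<psi>) \<bullet>c \<psi>"
    using assms unfolding quantum_correlations_def by blast
  note Xc = psd_matD(1)[OF X(1)] and Yc = psd_matD(1)[OF Y(1)]
  define \<Psi> where "\<Psi> = mat n m (\<lambda>(i, j). \<psi> $ (i * m + j))"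
  have \<Psi>: "\<Psi> \<in> carrier_mat n m" by (simp add: \<Psi>_def)
  have \<Psi>': "mat_adjoint \<Psi> \<in> carrier_mat m n" using \<Psi> by simp
  \<comment> \<open>\<open>Z t b\<close> is Bob's operator transported to Alice's space. For each
    \<open>t\<close> these operators sum to the same \<open>R\<close>, because Bob's measurements
    sum to the identity.\<close>
  define Z where "Z t b = \<Psi> * transpose_mat (Y t b) * mat_adjoint \<Psi>" for t b
  define R where "R = \<Psi> * mat_adjoint \<Psi>"
  have Z: "psd_mat n (Z t b)" for t b
    unfolding Z_def using psd_mat_congruence[OF psd_mat_transpose[OF Y(1)] \<Psi>'] by simp
  have ZR: "mat_sum n (Z t) = R" for t
  proof -
    have "mat_sum n (\<lambda>b. Z t b) = \<Psi> * mat_sum m (\<lambda>b. transpose_mat (Y t b)) * mat_adjoint \<Psi>"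
      unfolding Z_def by (rule mat_sum_congruence) (use Yc \<Psi> \<Psi>' in auto)
    then show ?thesis using \<Psi> Yc by (simp add: mat_sum_transpose[of "Y t" m] Y(2) R_def)
  qed
  \<comment> \<open>Any question serves here, since the sum \<open>R\<close> is the same for all of
    them.\<close>
  have "psd_mat n R" using psd_mat_sum[of n "Z undefined", OF Z] by (simp add: ZR)
  then obtain U r where U: "U \<in> carrier_mat n n" "mat_adjoint U * U = 1\<^sub>m n"
    and r: "\<And>i. i < n \<Longrightarrow> 0 \<le> r i" "mat_adjoint U * R * U = mat_diag n (\<lambda>i. complex_of_real (r i))"
    using psd_mat_diagonalization by blast
  have U': "mat_adjoint U \<in> carrier_mat n n" using U by simp
  define XU where "XU s a = mat_adjoint U * X s a * U" for s a
  define ZU where "ZU t b = mat_adjoint U * Z t b * U" for t b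
  have XU: "psd_mat n (XU s a)" "mat_sum n (XU s) = mat_diag n (\<lambda>i. complex_of_real 1)" for s a
  proof -
    show "psd_mat n (XU s a)" unfolding XU_def by (rule psd_mat_congruence[OF X(1) U(1)])
    have "mat_sum n (\<lambda>a. XU s a) = mat_adjoint U * 1\<^sub>m n * U"
      unfolding XU_def mat_sum_congruence[OF Xc U' U(1)] X(2) ..
    then show "mat_sum n (XU s) = mat_diag n (\<lambda>i. complex_of_real 1)" using U U' by simp
  qed
  have ZU: "psd_mat n (ZU t b)" "mat_sum n (ZU t) = mat_diag n (\<lambda>i. complex_of_real (r i))" for t b
  proof -
    show "psd_mat n (ZU t b)" unfolding ZU_def by (rule psd_mat_congruence[OF Z U(1)])
    have "mat_sum n (\<lambda>b. ZU t b) = mat_adjoint U * R * U"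
      unfolding ZU_def mat_sum_congruence[OF psd_matD(1)[OF Z] U' U(1)] ZR ..
    then show "mat_sum n (ZU t) = mat_diag n (\<lambda>i. complex_of_real (r i))" by (simp add: r(2))
  qed
  \<comment> \<open>The eigenvalues \<open>r\<close> of \<open>R\<close> are the squared Schmidt
    coefficients. So far Alice's family sums to 1 and Bob's to \<open>r\<close>; multiplying the
    first and dividing the second by \<open>c\<close> on both sides makes both sum to
    \<open>l\<close>, the square root of \<open>r\<close>.\<close>
  define l where "l i = sqrt (r i)" for i
  define c where "c i = sqrt (l i)" for i
  \<comment> \<open>Where \<open>r i = 0\<close> this inverse is the junk value \<open>0\<close>, so the corresponding rows and columns
     of \<open>N\<close> below vanish; those of \<open>ZU\<close> do too.\<close>
  define ic where "ic i = inverse (c i)" for i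
  let ?E = "mat_diag n (\<lambda>i. complex_of_real (c i))" and ?I = "mat_diag n (\<lambda>i. complex_of_real (ic i))"
  define M where "M s a = ?E * XU s a * ?E" for s a
  define N where "N t b = ?I * ZU t b * ?I" for t b
  have M: "psd_mat n (M s a)" "mat_sum n (M s) = mat_diag n (\<lambda>i. complex_of_real (l i))" for s a
  proof -
    show "psd_mat n (M s a)" unfolding M_def by (rule psd_diag_sandwich[OF XU(1)])
    have "mat_sum n (\<lambda>a. M s a) = mat_diag n (\<lambda>i. complex_of_real (c i) * complex_of_real 1 * complex_of_real (c i))"
      unfolding M_def by (rule mat_sum_diag_sandwich[OF psd_matD(1)[OF XU(1)] XU(2)])
    also have "\<dots> = mat_diag n (\<lambda>i. complex_of_real (l i))"
      using r(1) by (intro mat_diag_cong) (simp add: c_def l_def flip: of_real_mult)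
    finally show "mat_sum n (M s) = mat_diag n (\<lambda>i. complex_of_real (l i))" by simp
  qed
  have N: "psd_mat n (N t b)" "mat_sum n (N t) = mat_diag n (\<lambda>i. complex_of_real (l i))" for t b
  proof -
    show "psd_mat n (N t b)" unfolding N_def by (rule psd_diag_sandwich[OF ZU(1)])
    have "ic i * r i * ic i = l i" if "i < n" for i
    proof -
      have "r i = l i * l i" "l i = c i * c i" using r(1)[OF that] by (simp_all add: c_def l_def)
      then show ?thesis by (cases "c i = 0") (simp_all add: ic_def)
    qed
    moreover have "mat_sum n (\<lambda>b. N t b) = mat_diag n (\<lambda>i. complex_of_real (ic i) * complex_of_real (r i) * complex_of_real (ic i))"
      unfolding N_def by (rule mat_sum_diag_sandwich[OF psd_matD(1)[OF ZU(1)] ZU(2)])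
    ultimately show "mat_sum n (N t) = mat_diag n (\<lambda>i. complex_of_real (l i))"
      by (simp flip: of_real_mult cong: mat_diag_cong)
  qed
  have pMN: "complex_of_real (p a b s t) = mat_trace (M s a * N t b)" for a b s t
  proof -
    have "mat_trace (M s a * N t b) = (\<Sum>i<n. \<Sum>j<n. XU s a $$ (i, j) * ZU t b $$ (j, i))"
      unfolding mat_trace_mult[OF psd_matD(1)[OF M(1)] psd_matD(1)[OF N(1)]]
    proof (intro sum.cong refl)
      fix i j assume "i \<in> {..<n}" "j \<in> {..<n}"
      then have ij: "i < n" "j < n" by auto
      have "M s a $$ (i, j) * N t b $$ (j, i) =
          (complex_of_real (c i) * complex_of_real (ic i)) * (complex_of_real (c j) * complex_of_real (ic j)) *
            (XU s a $$ (i, j) * ZU t b $$ (j, i))"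
        unfolding M_def N_def diag_sandwich_index[OF psd_matD(1)[OF XU(1)] ij]
          diag_sandwich_index[OF psd_matD(1)[OF ZU(1)] ij(2,1)] by (simp only: ac_simps)
      also have "\<dots> = XU s a $$ (i, j) * ZU t b $$ (j, i)"
      proof (cases "r i = 0 \<or> r j = 0")
        case True
        then show ?thesis
          using psd_family_zero[OF ZU(1,2) ij, of t b] psd_family_zero[OF ZU(1,2) ij(2,1), of t b] by auto
      next
        case False
        then have "c i * ic i = 1" "c j * ic j = 1" by (auto simp: c_def ic_def l_def)
        then show ?thesis by (simp flip: of_real_mult)
      qed
      finally show "M s a $$ (i, j) * N t b $$ (j, i) = XU s a $$ (i, j) * ZU t b $$ (j, i)" .
    qed
    also have "\<dots> = mat_trace (XU s a * ZU t b)"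
      by (rule mat_trace_mult[OF psd_matD(1)[OF XU(1)] psd_matD(1)[OF ZU(1)], symmetric])
    also have "\<dots> = mat_trace (X s a * Z t b)"
      unfolding XU_def ZU_def by (rule mat_trace_unitary_conjugation[OF U Xc psd_matD(1)[OF Z]])
    also have "\<dots> = complex_of_real (p a b s t)"
      unfolding pe Z_def \<Psi>_def by (rule trace_tensor_identity[OF Xc Yc \<psi>, symmetric])
    finally show ?thesis ..
  qed
  then have pRe: "p a b s t = Re (mat_trace (M s a * N t b))" for a b s t
    by (metis Re_complex_of_real)
  \<comment> \<open>The normalisation is read off from the total probability at one arbitrary
    question pair.\<close>
  have "(\<Sum>i<n. (l i)\<^sup>2) = (\<Sum>a\<in>UNIV. \<Sum>b\<in>UNIV. p a b undefined undefined)"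
    unfolding pRe using M N psd_matD(1) by (intro sum_trace_diag[symmetric]) blast+
  also have "\<dots> = 1" using p by (simp add: unrestricted_correlations_def)
  finally have "balanced_form n l M N"
    using M N r(1) by (simp add: balanced_form_def l_def)
  then show ?thesis using pRe by (rule that)
qed

text \<open>The trace of a product of two positive semidefinite matrices is real and nonnegative, so
  taking \<open>Re\<close> loses nothing.\<close>

lemma balanced_form_trace_real:
  assumes "balanced_form n l M N"
  shows "0 \<le> Re (mat_trace (M s a * N t b))"
    "complex_of_real (Re (mat_trace (M s a * N t b))) = mat_trace (M s a * N t b)"
proof -
  have "0 \<le> mat_trace (M s a * N t b)"
    using assms by (auto simp: balanced_form_def intro!: mat_trace_psd_nonneg)
  then show "0 \<le> Re (mat_trace (M s a * N t b))"
    "complex_of_real (Re (mat_trace (M s a * N t b))) = mat_trace (M s a * N t b)"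
    by (auto simp: less_eq_complex_def complex_eq_iff)
qed

lemma diagonal_vector_sum:
  fixes g :: "nat \<Rightarrow> complex"
  assumes "i < n"
  shows "(\<Sum>j<n. f j * (if i = j then g j else 0)) = f i * g i"
    "(\<Sum>j<n. f j * (if j = i then g j else 0)) = f i * g i"
  using assms by (simp_all add: if_distrib cong: if_cong)

text \<open>On the kernel of the diagonal matrix the rescaled family is completed to a measurement by
  the uniform one.\<close>

lemma normalized_family:
  fixes F :: "'i::finite \<Rightarrow> complex mat"
  assumes l: "\<And>i. i < n \<Longrightarrow> 0 \<le> l i" and F: "\<And>a. psd_mat n (F a)"
    and sum: "mat_sum n F = mat_diag n (\<lambda>i. complex_of_real (l i))"
  obtains X where "\<And>a. psd_mat n (X a)" "mat_sum n X = 1\<^sub>m n"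
    "\<And>a i j. i < n \<Longrightarrow> j < n \<Longrightarrow> l i \<noteq> 0 \<Longrightarrow> l j \<noteq> 0 \<Longrightarrow>
      X a $$ (i, j) = F a $$ (i, j) / complex_of_real (sqrt (l i * l j))"
proof -
  \<comment> \<open>Where \<open>l i = 0\<close>, the convention \<open>inverse 0 = 0\<close> wipes
    out the rescaled part, and \<open>k\<close> supplies equal shares of the identity; elsewhere
    \<open>k\<close> is zero.\<close>
  define ic where "ic i = inverse (sqrt (l i))" for i
  define k where "k i = of_bool (l i = 0) / real (card (UNIV :: 'i set))" for i
  let ?I = "mat_diag n (\<lambda>i. complex_of_real (ic i))" and ?K = "mat_diag n (\<lambda>i. complex_of_real (k i))"
  define X where "X a = ?I * F a * ?I + ?K" for a
  have entry: "X a $$ (i, j) = complex_of_real (ic i) * F a $$ (i, j) * complex_of_real (ic j) +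
      (if i = j then complex_of_real (k j) else 0)" if "i < n" "j < n" for a i j
  proof -
    have "X a $$ (i, j) = (?I * F a * ?I) $$ (i, j) + ?K $$ (i, j)"
      unfolding X_def by (rule index_add_mat(1)) (use that in \<open>auto simp: mat_diag_def\<close>)
    then show ?thesis
      using that by (simp only: diag_sandwich_index[OF psd_matD(1)[OF F]]) (simp add: mat_diag_def)
  qed
  have "psd_mat n (X a)" for a
    unfolding X_def by (intro psd_mat_add psd_diag_sandwich F psd_mat_mat_diag) (simp add: k_def)
  moreover have "mat_sum n X = 1\<^sub>m n"
  proof (rule eq_matI)
    fix i j assume "i < dim_row (1\<^sub>m n :: complex mat)" "j < dim_col (1\<^sub>m n :: complex mat)"
    then have ij: "i < n" "j < n" by auto
    have "mat_sum n X $$ (i, j) = complex_of_real (ic i) * mat_sum n F $$ (i, j) * complex_of_real (ic j) +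
        (if i = j then of_nat (card (UNIV :: 'i set)) * complex_of_real (k j) else 0)"
      using ij by (simp add: entry sum.distrib sum_distrib_left sum_distrib_right)
    also have "\<dots> = (if i = j then complex_of_real (ic j * l j * ic j + real (card (UNIV :: 'i set)) * k j) else 0)"
      using ij by (simp add: sum mat_diag_def)
    also have "ic j * l j * ic j + real (card (UNIV :: 'i set)) * k j = 1"
      using l[OF ij(2)] by (cases "l j = 0") (auto simp: ic_def k_def field_simps)
    finally show "mat_sum n X $$ (i, j) = 1\<^sub>m n $$ (i, j)" using ij by simp
  qed simp_all
  moreover have "X a $$ (i, j) = F a $$ (i, j) / complex_of_real (sqrt (l i * l j))"
    if "i < n" "j < n" "l i \<noteq> 0" "l j \<noteq> 0" for a i j
    using that by (simp add: entry k_def ic_def real_sqrt_mult field_simps)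
  ultimately show ?thesis by (rule that)
qed

lemma balanced_form_imp_quantum:
  fixes M :: "'s::finite \<Rightarrow> 'a::finite \<Rightarrow> complex mat" and N :: "'t::finite \<Rightarrow> 'b::finite \<Rightarrow> complex mat"
  assumes bal: "balanced_form n l M N"
  shows "(\<lambda>a b s t. Re (mat_trace (M s a * N t b))) \<in> quantum_correlations"
proof -
  have l: "\<And>i. i < n \<Longrightarrow> 0 \<le> l i" and l1: "(\<Sum>i<n. (l i)\<^sup>2) = 1"
    and M: "\<And>s a. psd_mat n (M s a)" "\<And>s. mat_sum n (M s) = mat_diag n (\<lambda>i. complex_of_real (l i))"
    and N: "\<And>t b. psd_mat n (N t b)" "\<And>t. mat_sum n (N t) = mat_diag n (\<lambda>i. complex_of_real (l i))"
    using bal by (auto simp: balanced_form_def)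
  note Mc = psd_matD(1)[OF M(1)] and Nc = psd_matD(1)[OF N(1)]
  have unr: "(\<lambda>a b s t. Re (mat_trace (M s a * N t b))) \<in> unrestricted_correlations"
    using balanced_form_trace_real(1)[OF bal] sum_trace_diag[OF Mc Nc M(2) N(2)] l1
    by (simp add: unrestricted_correlations_def)
  have "\<exists>X. (\<forall>a. psd_mat n (X a)) \<and> mat_sum n X = 1\<^sub>m n \<and>
      (\<forall>a i j. i < n \<longrightarrow> j < n \<longrightarrow> l i \<noteq> 0 \<longrightarrow> l j \<noteq> 0 \<longrightarrow>
        X a $$ (i, j) = M s a $$ (i, j) / complex_of_real (sqrt (l i * l j)))" for s
    using normalized_family[of n l "M s", OF l M] by metis
  then obtain X where X: "\<And>s a. psd_mat n (X s a)" "\<And>s. mat_sum n (X s) = 1\<^sub>m n"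
      "\<And>s a i j. i < n \<Longrightarrow> j < n \<Longrightarrow> l i \<noteq> 0 \<Longrightarrow> l j \<noteq> 0 \<Longrightarrow>
        X s a $$ (i, j) = M s a $$ (i, j) / complex_of_real (sqrt (l i * l j))"
    by metis
  have "\<exists>Y. (\<forall>b. psd_mat n (Y b)) \<and> mat_sum n Y = 1\<^sub>m n \<and>
      (\<forall>b i j. i < n \<longrightarrow> j < n \<longrightarrow> l i \<noteq> 0 \<longrightarrow> l j \<noteq> 0 \<longrightarrow>
        Y b $$ (i, j) = N t b $$ (i, j) / complex_of_real (sqrt (l i * l j)))" for t
    using normalized_family[of n l "N t", OF l N] by metis
  then obtain Y where Y: "\<And>t b. psd_mat n (Y t b)" "\<And>t. mat_sum n (Y t) = 1\<^sub>m n"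
      "\<And>t b i j. i < n \<Longrightarrow> j < n \<Longrightarrow> l i \<noteq> 0 \<Longrightarrow> l j \<noteq> 0 \<Longrightarrow>
        Y t b $$ (i, j) = N t b $$ (i, j) / complex_of_real (sqrt (l i * l j))"
    by metis
  note Xc = psd_matD(1)[OF X(1)] and Yc = psd_matD(1)[OF Y(1)]
  \<comment> \<open>This is the sum of \<open>l i\<close> times \<open>e_i\<close> tensor
    \<open>e_i\<close>, written in the index encoding \<open>i * n + j\<close>; it is a unit vector
    because the squares of \<open>l\<close> sum to 1.\<close>
  define \<psi> where "\<psi> = vec (n * n) (\<lambda>k. if k div n = k mod n then complex_of_real (l (k mod n)) else 0)"
  have \<psi>: "\<psi> \<in> carrier_vec (n * n)" by (simp add: \<psi>_def)
  have \<psi>i: "\<psi> $ (i * n + j) = (if i = j then complex_of_real (l j) else 0)" if "i < n" "j < n" for i j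
    using that by (simp add: \<psi>_def index_lessThan_prod)
  have "\<psi> \<bullet>c \<psi> = (\<Sum>i<n. \<Sum>j<n. \<psi> $ (i * n + j) * cnj (\<psi> $ (i * n + j)))"
    unfolding cscalar_prod_sum[OF carrier_vecD[OF \<psi>]] sum_lessThan_prod by simp
  also have "\<dots> = (\<Sum>i<n. \<Sum>j<n. complex_of_real (l j) * (if i = j then complex_of_real (l j) else 0))"
    by (intro sum.cong refl) (simp add: \<psi>i)
  also have "\<dots> = (\<Sum>i<n. complex_of_real ((l i)\<^sup>2))"
    by (intro sum.cong refl) (simp add: diagonal_vector_sum power2_eq_square)
  also have "\<dots> = 1" using l1 by (metis of_real_1 of_real_sum)
  finally have \<psi>1: "\<psi> \<bullet>c \<psi> = 1" .
  \<comment> \<open>With \<open>D\<close> the diagonal matrix of \<open>l\<close>, the right-hand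
    side is the trace of \<open>X D Y D\<close>. Bob measures with the transpose of
    \<open>Y\<close>, which undoes the transposition caused by reshaping.\<close>
  have tr: "mat_trace (M s a * N t b) = (tensor_mat (X s a) (transpose_mat (Y t b)) *\<^sub>v \<psi>) \<bullet>c \<psi>" for a b s t
  proof -
    have YT: "transpose_mat (Y t b) \<in> carrier_mat n n" using Yc by simp
    have "(tensor_mat (X s a) (transpose_mat (Y t b)) *\<^sub>v \<psi>) \<bullet>c \<psi> =
        (\<Sum>i<n. \<Sum>j<n. \<Sum>i'<n. \<Sum>j'<n. X s a $$ (i, i') * Y t b $$ (j', j) *
          (if i' = j' then complex_of_real (l j') else 0) * (if i = j then complex_of_real (l j) else 0))"
      unfolding tensor_quadratic_form[OF Xc YT \<psi>]
      using Yc[of t b] by (intro sum.cong refl) (auto simp: \<psi>i)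
    also have "\<dots> = (\<Sum>i<n. \<Sum>j<n. (\<Sum>i'<n. X s a $$ (i, i') * Y t b $$ (i', j) *
          complex_of_real (l i')) * (if i = j then complex_of_real (l j) else 0))"
      by (intro sum.cong refl) (simp add: diagonal_vector_sum flip: sum_distrib_right)
    also have "\<dots> = (\<Sum>i<n. \<Sum>i'<n. X s a $$ (i, i') * Y t b $$ (i', i) *
          complex_of_real (l i') * complex_of_real (l i))"
      by (rule sum.cong[OF refl], simp only: lessThan_iff diagonal_vector_sum) (simp only: sum_distrib_right)
    also have "\<dots> = (\<Sum>i<n. \<Sum>i'<n. M s a $$ (i, i') * N t b $$ (i', i))"
    proof (intro sum.cong refl)
      fix i j assume "i \<in> {..<n}" "j \<in> {..<n}"
      then have ij: "i < n" "j < n" by auto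
      show "X s a $$ (i, j) * Y t b $$ (j, i) * complex_of_real (l j) * complex_of_real (l i) =
          M s a $$ (i, j) * N t b $$ (j, i)"
      \<comment> \<open>On the kernel the left side has a factor 0 and the entry of \<open>M\<close>
        vanishes; off it, the two factors \<open>1 / w\<close> from \<open>X\<close> and
        \<open>Y\<close> cancel \<open>l i * l j\<close>.\<close>
      proof (cases "l i = 0 \<or> l j = 0")
        case True
        then have "M s a $$ (i, j) = 0"
          using psd_family_zero[OF M ij, of s a] psd_family_zero[OF M ij(2,1), of s a] by auto
        with True show ?thesis by auto
      next
        case False
        define w where "w = sqrt (l i * l j)"
        have w: "w * w = l i * l j" "w \<noteq> 0"
          using l[OF ij(1)] l[OF ij(2)] False by (auto simp: w_def)
        have "X s a $$ (i, j) = M s a $$ (i, j) / complex_of_real w"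
          "Y t b $$ (j, i) = N t b $$ (j, i) / complex_of_real w"
          using False X(3)[OF ij] Y(3)[OF ij(2,1)] by (simp_all add: w_def mult.commute)
        then have "X s a $$ (i, j) * Y t b $$ (j, i) * complex_of_real (l j) * complex_of_real (l i) =
            M s a $$ (i, j) * N t b $$ (j, i) * (complex_of_real (l i * l j) / complex_of_real (w * w))"
          by (simp add: mult_ac)
        then show ?thesis using w False by simp
      qed
    qed
    also have "\<dots> = mat_trace (M s a * N t b)" by (rule mat_trace_mult[OF Mc Nc, symmetric])
    finally show ?thesis ..
  qed
  have YT: "psd_mat n (transpose_mat (Y t b))" "mat_sum n (\<lambda>b. transpose_mat (Y t b)) = 1\<^sub>m n" for t b
    by (simp_all add: psd_mat_transpose Y mat_sum_transpose[OF Yc])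
  have eq: "complex_of_real (Re (mat_trace (M s a * N t b))) =
      (tensor_mat (X s a) (transpose_mat (Y t b)) *\<^sub>v \<psi>) \<bullet>c \<psi>" for a b s t
    unfolding balanced_form_trace_real(2)[OF bal] by (rule tr)
  show ?thesis
    unfolding quantum_correlations_def
    by (rule CollectI, rule conjI[OF unr],
        rule exI[of _ n], rule exI[of _ n], rule exI[of _ \<psi>], rule exI[of _ X],
        rule exI[of _ "\<lambda>t b. transpose_mat (Y t b)"])
      (intro conjI allI \<psi> \<psi>1 X(1,2) YT eq)
qed

section \<open>Real matrices from complex ones\<close>

definition realification :: "nat \<Rightarrow> complex mat \<Rightarrow> real mat" where
  "realification n M = mat (n + n) (n + n) (\<lambda>(i, j).
     (if i < n then if j < n then Re (M $$ (i, j)) else - Im (M $$ (i, j - n))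
      else if j < n then Im (M $$ (i - n, j)) else Re (M $$ (i - n, j - n))) / sqrt 2)"

lemma sum_lessThan_double:
  fixes f :: "nat \<Rightarrow> 'k::comm_monoid_add"
  shows "(\<Sum>k<n + n. f k) = (\<Sum>i<n. f i) + (\<Sum>i<n. f (n + i))"
  using sum.atLeastLessThan_concat[of 0 n "n + n" f] sum.shift_bounds_nat_ivl[of f 0 n n]
  by (simp add: atLeast0LessThan add.commute)

text \<open>At a real vector with halves \<open>x\<close> and \<open>y\<close> the form is the real
  part of the form of \<open>M\<close> at \<open>x + i y\<close>, divided by \<open>sqrt 2\<close>.
  Symmetry comes from the antisymmetry of the imaginary part of \<open>M\<close>.\<close>

lemma realification_psd:
  assumes M: "psd_mat n M"
  shows "psd_mat (n + n) (realification n M)"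
proof -
  have H: "Re (M $$ (j, i)) = Re (M $$ (i, j))" "Im (M $$ (j, i)) = - Im (M $$ (i, j))"
    if "i < n" "j < n" for i j
    using psd_matD(4)[OF M that] by (auto simp: complex_eq_iff)
  have "0 \<le> (\<Sum>i<n+n. \<Sum>j<n+n. realification n M $$ (i, j) * v j * v i)" for v :: "nat \<Rightarrow> real"
  proof -
    have sqrt2: "sqrt 2 * (sqrt 2 * x) = 2 * x" for x by (simp flip: mult.assoc)
    define z where "z i = Complex (v i) (v (n + i))" for i
    have "(\<Sum>i<n+n. \<Sum>j<n+n. realification n M $$ (i, j) * v j * v i) =
        (\<Sum>i<n. \<Sum>j<n. Re (M $$ (i, j) * z j * cnj (z i)) / sqrt 2)"
      unfolding sum_lessThan_double sum.distrib[symmetric]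
      by (intro sum.cong refl) (simp add: realification_def z_def field_simps sqrt2)
    also have "\<dots> = Re (\<Sum>i<n. \<Sum>j<n. M $$ (i, j) * z j * conjugate (z i)) / sqrt 2"
      by (simp add: sum_divide_distrib del: times_complex.sel cnj.sel)
    also have "\<dots> \<ge> 0"
      using M unfolding psd_mat_iff by (auto simp: less_eq_complex_def simp del: conjugate_complex_def)
    finally show ?thesis .
  qed
  moreover have "realification n M $$ (j, i) = realification n M $$ (i, j)" if "i < n + n" "j < n + n" for i j
    using that H[of i j] H[of i "j - n"] H[of j "i - n"] H[of "i - n" "j - n"]
    by (cases "i < n"; cases "j < n") (simp_all add: realification_def)
  ultimately show ?thesis
    unfolding psd_mat_iff by (simp add: realification_def)
qed

text \<open>The two diagonal blocks of the product each contribute half of the real part of the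
  trace of \<open>M * N\<close>; the factors \<open>1 / sqrt 2\<close> produce exactly these
  halves.\<close>

lemma trace_realification:
  assumes M: "psd_mat n M" and N: "psd_mat n N"
  shows "mat_trace (realification n M * realification n N) = Re (mat_trace (M * N))"
proof -
  have c: "realification n M \<in> carrier_mat (n + n) (n + n)" for M by (simp add: realification_def)
  have half: "x / sqrt 2 * (y / sqrt 2) = x * y / 2" for x y by simp
  show ?thesis
    unfolding mat_trace_mult[OF c c] mat_trace_mult[OF psd_matD(1)[OF M] psd_matD(1)[OF N]]
      sum_lessThan_double sum.distrib[symmetric] Re_sum
    by (intro sum.cong refl) (simp add: realification_def half)
qed

section \<open>The feasibility problems\<close>

lemma sum_block [simp]:
  fixes f :: "('a::finite, 'b::finite, 's::finite, 't::finite) index \<Rightarrow> 'k::comm_monoid_add"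
  shows "(\<Sum>u\<in>block (Inl s). f u) = (\<Sum>a\<in>UNIV. f (Inl (s, a)))"
    "(\<Sum>u\<in>block (Inr t). f u) = (\<Sum>b\<in>UNIV. f (Inr (t, b)))"
proof -
  have "(block (Inl s) :: ('a, 'b, 's, 't) index set) = (\<lambda>a. Inl (s, a)) ` UNIV"
    "(block (Inr t) :: ('a, 'b, 's, 't) index set) = (\<lambda>b. Inr (t, b)) ` UNIV"
    by auto
  moreover have "inj (\<lambda>a. Inl (s, a) :: ('a, 'b, 's, 't) index)" "inj (\<lambda>b. Inr (t, b) :: ('a, 'b, 's, 't) index)"
    by (auto intro: injI)
  ultimately show "(\<Sum>u\<in>block (Inl s). f u) = (\<Sum>a\<in>UNIV. f (Inl (s, a)))"
    "(\<Sum>u\<in>block (Inr t). f u) = (\<Sum>b\<in>UNIV. f (Inr (t, b)))"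
    by (simp_all only: sum.reindex comp_def)
qed

declare block.simps [simp del]

lemma mem_block: "Inl (s, a) \<in> block (Inl s)" "Inr (t, b) \<in> block (Inr t)"
  by (simp_all add: block.simps)

text \<open>The winning probability is 1 minus the \<open>\<pi>\<close>-average of the losing
  probabilities \<open>f s t\<close>. An average of nonnegative terms is zero only if every term of
  positive weight is zero.\<close>

lemma perfect_iff_vanishing:
  fixes p :: "('a::finite, 'b::finite, 's::finite, 't::finite) correlation"
  assumes \<pi>: "prob_distribution \<pi>" and p: "p \<in> unrestricted_correlations"
  shows "(\<Sum>s\<in>UNIV. \<Sum>t\<in>UNIV. \<pi> s t * (\<Sum>a\<in>UNIV. \<Sum>b\<in>UNIV. of_bool (V a b s t) * p a b s t)) = 1 \<longleftrightarrow>
    (\<forall>a b s t. \<pi> s t > 0 \<and> \<not> V a b s t \<longrightarrow> p a b s t = 0)"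
proof -
  have nn: "0 \<le> p a b s t" "0 \<le> \<pi> s t" for a b s t
    using p \<pi> by (auto simp: unrestricted_correlations_def prob_distribution_def)
  define f where "f s t = (\<Sum>a\<in>UNIV. \<Sum>b\<in>UNIV. of_bool (\<not> V a b s t) * p a b s t)" for s t
  have f: "(\<Sum>a\<in>UNIV. \<Sum>b\<in>UNIV. of_bool (V a b s t) * p a b s t) = 1 - f s t" for s t
  proof -
    have "1 = (\<Sum>a\<in>UNIV. \<Sum>b\<in>UNIV. p a b s t)"
      using p by (simp add: unrestricted_correlations_def)
    also have "\<dots> = (\<Sum>a\<in>UNIV. \<Sum>b\<in>UNIV. of_bool (V a b s t) * p a b s t) + f s t"
      unfolding f_def sum.distrib[symmetric] by (intro sum.cong refl) auto
    finally show ?thesis by simp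
  qed
  have f0: "f s t = 0 \<longleftrightarrow> (\<forall>a b. \<not> V a b s t \<longrightarrow> p a b s t = 0)" for s t
    by (auto simp: f_def sum_nonneg_eq_0_iff sum_nonneg nn)
  have fnn: "0 \<le> f s t" for s t
    unfolding f_def using nn by (intro sum_nonneg) auto
  have "(\<Sum>s\<in>UNIV. \<Sum>t\<in>UNIV. \<pi> s t * (\<Sum>a\<in>UNIV. \<Sum>b\<in>UNIV. of_bool (V a b s t) * p a b s t)) =
      1 - (\<Sum>s\<in>UNIV. \<Sum>t\<in>UNIV. \<pi> s t * f s t)"
    unfolding f right_diff_distrib sum_subtractf using \<pi> by (simp add: prob_distribution_def)
  moreover have "(\<Sum>s\<in>UNIV. \<Sum>t\<in>UNIV. \<pi> s t * f s t) = 0 \<longleftrightarrow> (\<forall>s t. \<pi> s t * f s t = 0)"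
    using nn fnn by (simp add: sum_nonneg_eq_0_iff sum_nonneg)
  moreover have "\<pi> s t * f s t = 0 \<longleftrightarrow> (\<pi> s t > 0 \<longrightarrow> f s t = 0)" for s t
    using nn(2)[of s t] by auto
  ultimately show ?thesis by (auto simp: f0)
qed

text \<open>The common reduction for all four equivalences: as the mixed blocks of \<open>X\<close>
  are exactly \<open>p\<close>, the zero pattern passes between them, and only the correspondence of
  sets and cones without reference to \<open>V\<close> is left.\<close>

lemma perfect_strategy_iff_conic_feasible:
  fixes \<C> :: "('a::finite, 'b::finite, 's::finite, 't::finite) correlation set"
  assumes \<pi>: "prob_distribution \<pi>" and sub: "\<C> \<subseteq> unrestricted_correlations"
    and fwd: "\<And>p. p \<in> \<C> \<Longrightarrow> \<exists>X\<in>\<K>. (\<forall>i j. block_sum i j X = 1) \<and>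
      (\<forall>a b s t. X (Inl (s, a)) (Inr (t, b)) = p a b s t)"
    and bwd: "\<And>X. X \<in> \<K> \<Longrightarrow> (\<And>i j. block_sum i j X = 1) \<Longrightarrow>
      (\<lambda>a b s t. X (Inl (s, a)) (Inr (t, b))) \<in> \<C>"
  shows "admits_perfect_strategy \<C> \<pi> V \<longleftrightarrow> conic_feasible \<K> \<pi> V"
proof
  assume "admits_perfect_strategy \<C> \<pi> V"
  then obtain p where p: "p \<in> \<C>" and one: "(\<Sum>s\<in>UNIV. \<Sum>t\<in>UNIV. \<pi> s t *
      (\<Sum>a\<in>UNIV. \<Sum>b\<in>UNIV. of_bool (V a b s t) * p a b s t)) = 1"
    unfolding admits_perfect_strategy_def by (elim bexE)
  obtain X where X: "X \<in> \<K>" "\<forall>i j. block_sum i j X = 1"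
    "\<And>a b s t. X (Inl (s, a)) (Inr (t, b)) = p a b s t"
    using fwd[OF p] by blast
  from one have "\<forall>a b s t. \<pi> s t > 0 \<and> \<not> V a b s t \<longrightarrow> X (Inl (s, a)) (Inr (t, b)) = 0"
    unfolding perfect_iff_vanishing[OF \<pi> subsetD[OF sub p]] X(3) .
  with X(1,2) show "conic_feasible \<K> \<pi> V"
    unfolding conic_feasible_def by (intro bexI[of _ X] conjI)
next
  assume "conic_feasible \<K> \<pi> V"
  then obtain X where X: "X \<in> \<K>" "\<forall>i j. block_sum i j X = 1"
    "\<forall>a b s t. \<pi> s t > 0 \<and> \<not> V a b s t \<longrightarrow> X (Inl (s, a)) (Inr (t, b)) = 0"
    unfolding conic_feasible_def by (elim bexE conjE)
  have C: "(\<lambda>a b s t. X (Inl (s, a)) (Inr (t, b))) \<in> \<C>"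
    using X(2) by (intro bwd[OF X(1)]) blast
  show "admits_perfect_strategy \<C> \<pi> V"
    unfolding admits_perfect_strategy_def
    by (rule bexI[OF _ C]) (use perfect_iff_vanishing[OF \<pi> subsetD[OF sub C]] X(3) in \<open>simp only:\<close>)
qed

section \<open>Extending a correlation by uniform blocks\<close>

fun uniform_extension ::
  "('a::finite, 'b::finite, 's::finite, 't::finite) correlation \<Rightarrow> ('a, 'b, 's, 't) game_matrix" where
  "uniform_extension p (Inl (s, a)) (Inl (s', a')) = 1 / (real (card (UNIV :: 'a set)))\<^sup>2"
| "uniform_extension p (Inl (s, a)) (Inr (t, b)) = p a b s t"
| "uniform_extension p (Inr (t, b)) (Inl (s, a)) = p a b s t"
| "uniform_extension p (Inr (t, b)) (Inr (t', b')) = 1 / (real (card (UNIV :: 'b set)))\<^sup>2"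

text \<open>The cone restricts the blocks inside \<open>S\<close> or inside \<open>T\<close> only by
  symmetry and nonnegativity, so spreading the total 1 evenly over them is enough.
  \<open>nso_cone\<close> adds equations on the mixed blocks alone.\<close>

lemma uniform_extension_feasible:
  assumes "p \<in> unrestricted_correlations"
  shows "uniform_extension p \<in> nonneg_cone" "block_sum i j (uniform_extension p) = 1"
proof -
  have "uniform_extension p u v = uniform_extension p v u" for u v
    by (cases "(p, u, v)" rule: uniform_extension.cases) auto
  moreover have "0 \<le> uniform_extension p u v" for u v
    using assms by (cases "(p, u, v)" rule: uniform_extension.cases) (auto simp: unrestricted_correlations_def)
  ultimately show "uniform_extension p \<in> nonneg_cone" by (simp add: nonneg_cone_def)
  have 1: "(\<Sum>a\<in>UNIV. \<Sum>b\<in>UNIV. p a b s t) = 1" for s t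
    using assms by (simp add: unrestricted_correlations_def)
  moreover have "(\<Sum>b\<in>UNIV. \<Sum>a\<in>UNIV. p a b s t) = 1" for s t
    using 1[of s t] by (subst sum.swap)
  ultimately show "block_sum i j (uniform_extension p) = 1"
    by (cases i; cases j) (simp_all add: block_sum_def power2_eq_square)
qed

lemma nonneg_imp_unrestricted:
  assumes "X \<in> nonneg_cone" "\<And>i j. block_sum i j X = 1"
  shows "(\<lambda>a b s t. X (Inl (s, a)) (Inr (t, b))) \<in> unrestricted_correlations"
  using assms(1) assms(2)[of "Inl _" "Inr _"]
  by (simp add: nonneg_cone_def unrestricted_correlations_def block_sum_def)

text \<open>The squared distance of \<open>f\<close> and \<open>g\<close> is
  \<open>1 + 1 - 2 = 0\<close>. It is stated over any finite index set, so that it applies to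
  vectors and to matrices read as vectors.\<close>

lemma unit_vectors_eq:
  fixes f g :: "'i \<Rightarrow> real"
  assumes "finite I" "(\<Sum>i\<in>I. f i * f i) = 1" "(\<Sum>i\<in>I. g i * g i) = 1" "(\<Sum>i\<in>I. f i * g i) = 1"
    and "i \<in> I"
  shows "f i = g i"
proof -
  have "(\<Sum>i\<in>I. (f i - g i)\<^sup>2) = (\<Sum>i\<in>I. f i * f i) + (\<Sum>i\<in>I. g i * g i) - 2 * (\<Sum>i\<in>I. f i * g i)"
    unfolding sum_distrib_left sum.distrib[symmetric] sum_subtractf[symmetric]
    by (intro sum.cong refl) (simp add: power2_eq_square algebra_simps)
  then have "(\<Sum>i\<in>I. (f i - g i)\<^sup>2) = 0" using assms by simp
  then show ?thesis using assms(1,5) by (simp add: sum_nonneg_eq_0_iff)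
qed

section \<open>The completely positive cone\<close>

lemma classical_imp_cp:
  fixes p :: "('a::finite, 'b::finite, 's::finite, 't::finite) correlation"
  assumes "p \<in> classical_correlations"
  shows "\<exists>X\<in>cp_cone. (\<forall>i j. block_sum i j X = 1) \<and> (\<forall>a b s t. X (Inl (s, a)) (Inr (t, b)) = p a b s t)"
proof -
  obtain n :: nat and k x y where nn: "\<forall>i<n. 0 \<le> k i \<and> (\<forall>s a. 0 \<le> x s a i) \<and> (\<forall>t b. 0 \<le> y t b i)"
    and k1: "(\<Sum>i<n. k i) = 1"
    and x1: "\<forall>i<n. \<forall>s. (\<Sum>a\<in>UNIV. x s a i) = 1" and y1: "\<forall>i<n. \<forall>t. (\<Sum>b\<in>UNIV. y t b i) = 1"
    and pe: "\<forall>a b s t. p a b s t = (\<Sum>i<n. k i * x s a i * y t b i)"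
    using assms unfolding classical_correlations_def by blast
  define z :: "('a, 'b, 's, 't) index \<Rightarrow> nat \<Rightarrow> real"
    where "z u i = (case u of Inl (s, a) \<Rightarrow> x s a i | Inr (t, b) \<Rightarrow> y t b i)" for u i
  \<comment> \<open>There is one coordinate per term of the convex combination; the factor
    \<open>sqrt (k i)\<close> in each vector gives the weight \<open>k i\<close> in their inner
    product.\<close>
  define v where "v u = vec n (\<lambda>i. sqrt (k i) * z u i)" for u
  define X where "X u u' = v u \<bullet> v u'" for u u'
  have znn: "0 \<le> z u i" if "i < n" for u i using nn that by (auto simp: z_def split: sum.split)
  have z1: "(\<Sum>u\<in>block j. z u i) = 1" if "i < n" for i j
    using x1 y1 that by (cases j) (simp_all add: z_def)
  have Xe: "X u u' = (\<Sum>i<n. k i * z u i * z u' i)" for u u'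
  proof -
    have "X u u' = (\<Sum>i<n. (sqrt (k i) * z u i) * (sqrt (k i) * z u' i))"
      by (simp add: X_def v_def scalar_prod_def atLeast0LessThan)
    also have "\<dots> = (\<Sum>i<n. (sqrt (k i) * sqrt (k i)) * z u i * z u' i)"
      by (simp only: mult_ac)
    also have "\<dots> = (\<Sum>i<n. k i * z u i * z u' i)"
      using nn by (intro sum.cong refl) simp
    finally show ?thesis .
  qed
  \<comment> \<open>The cone asks for dimension at least 1; an empty combination could not have
    weights summing to 1.\<close>
  have "n \<noteq> 0" using k1 by (intro notI) simp
  moreover have "\<forall>u. v u \<in> carrier_vec n \<and> (\<forall>i<n. 0 \<le> v u $ i)"
    using nn znn by (simp add: v_def)
  ultimately have "X \<in> cp_cone"
    unfolding cp_cone_def X_def by (intro CollectI exI[of _ n] conjI exI[of _ v]) auto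
  moreover have "block_sum i j X = 1" for i j
  proof -
    have "block_sum i j X = (\<Sum>l<n. \<Sum>u\<in>block i. \<Sum>u'\<in>block j. k l * z u l * z u' l)"
      unfolding block_sum_def Xe by (simp only: sum.swap[of _ "{..<n}" "block _"])
    also have "\<dots> = (\<Sum>l<n. k l * (\<Sum>u\<in>block i. z u l) * (\<Sum>u'\<in>block j. z u' l))"
      by (rule sum.cong[OF refl], simp only: mult.assoc sum_product) (simp only: sum_distrib_left)
    also have "\<dots> = 1" using k1 by (simp add: z1)
    finally show ?thesis .
  qed
  moreover have "X (Inl (s, a)) (Inr (t, b)) = p a b s t" for a b s t
    unfolding Xe pe[rule_format] by (simp add: z_def)
  ultimately show ?thesis by blast
qed

text \<open>Dividing coordinate \<open>l\<close> by the common block sum \<open>w l\<close> gives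
  local distributions for every question at once, and the two divisors are repaid by the weight
  \<open>w l * w l\<close>.\<close>

lemma cp_imp_classical:
  fixes X :: "('a::finite, 'b::finite, 's::finite, 't::finite) game_matrix"
  assumes "X \<in> cp_cone" and bs: "\<And>i j. block_sum i j X = 1"
  shows "(\<lambda>a b s t. X (Inl (s, a)) (Inr (t, b))) \<in> classical_correlations"
proof -
  obtain d v where v: "\<And>u. v u \<in> carrier_vec d" "\<And>u i. i < d \<Longrightarrow> 0 \<le> v u $ i"
    and Xv: "\<And>u u'. X u u' = v u \<bullet> v u'"
    using assms(1) unfolding cp_cone_def by blast
  have Xe: "X u u' = (\<Sum>i<d. v u $ i * v u' $ i)" for u u'
    using v(1)[of u'] by (simp add: Xv scalar_prod_def atLeast0LessThan)
  define W where "W j i = (\<Sum>u\<in>block j. v u $ i)" for j :: "'s + 't" and i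
  have WW: "(\<Sum>l<d. W i l * W j l) = 1" for i j
  proof -
    have "1 = (\<Sum>l<d. \<Sum>u\<in>block i. \<Sum>u'\<in>block j. v u $ l * v u' $ l)"
      unfolding bs[of i j, symmetric] block_sum_def Xe by (simp only: sum.swap[of _ "{..<d}" "block _"])
    also have "\<dots> = (\<Sum>l<d. W i l * W j l)" by (simp add: W_def sum_product)
    finally show ?thesis ..
  qed
  define w where "w = W (Inl undefined)"
  have Ww: "W j l = w l" if "l < d" for j l
    using unit_vectors_eq[of "{..<d}" "W j" w l] WW that by (simp add: w_def)
  \<comment> \<open>Every index lies in some block, and nonnegative entries with sum
    \<open>w l = 0\<close> vanish individually.\<close>
  have zero: "v u $ l = 0" if "l < d" "w l = 0" for u l
  proof -
    obtain j where "u \<in> block j"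
      by (metis mem_block sumE surj_pair)
    moreover have "finite (block j :: ('a, 'b, 's, 't) index set)" by (rule finite)
    moreover have "(\<Sum>u\<in>block j. v u $ l) = 0" using Ww[OF that(1), of j] that(2) by (simp add: W_def)
    ultimately show ?thesis using v(2)[OF that(1)] by (simp add: sum_nonneg_eq_0_iff)
  qed
  have wnn: "0 \<le> w l" if "l < d" for l
    using v(2)[OF that] by (simp add: w_def W_def sum_nonneg)
  \<comment> \<open>For \<open>w l = 0\<close> the uniform distribution is a filler: the coordinate
    has weight 0, and the entries of \<open>v\<close> vanish there too.\<close>
  define x where "x s a l = (if w l = 0 then 1 / card (UNIV :: 'a set) else v (Inl (s, a)) $ l / w l)" for s a l
  define y where "y t b l = (if w l = 0 then 1 / card (UNIV :: 'b set) else v (Inr (t, b)) $ l / w l)" for t b l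
  have "X \<in> nonneg_cone"
    using v(2) by (auto simp: nonneg_cone_def Xe mult.commute intro!: sum_nonneg)
  then have unr: "(\<lambda>a b s t. X (Inl (s, a)) (Inr (t, b))) \<in> unrestricted_correlations"
    using bs by (rule nonneg_imp_unrestricted)
  have nn: "0 \<le> x s a l" "0 \<le> y t b l" if "l < d" for s a t b l
    using that v(2) wnn by (simp_all add: x_def y_def)
  have sum1: "(\<Sum>a\<in>UNIV. x s a l) = 1" "(\<Sum>b\<in>UNIV. y t b l) = 1" if "l < d" for s t l
    using Ww[OF that, of "Inl s"] Ww[OF that, of "Inr t"]
    by (cases "w l = 0"; simp add: x_def y_def W_def flip: sum_divide_distrib)+
  have k1: "(\<Sum>l<d. w l * w l) = 1" using WW by (simp add: w_def)
  have "X (Inl (s, a)) (Inr (t, b)) = (\<Sum>l<d. w l * w l * x s a l * y t b l)" for a b s t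
    unfolding Xe by (intro sum.cong refl) (auto simp: x_def y_def zero)
  with nn sum1 k1 unr show ?thesis
    unfolding classical_correlations_def
    by (intro CollectI conjI exI[of _ d] exI[of _ "\<lambda>l. w l * w l"] exI[of _ x] exI[of _ y]) auto
qed

section \<open>The completely positive semidefinite cone\<close>

lemma quantum_imp_cs_plus:
  fixes p :: "('a::finite, 'b::finite, 's::finite, 't::finite) correlation"
  assumes "p \<in> quantum_correlations"
  shows "\<exists>X\<in>cs_plus_cone. (\<forall>i j. block_sum i j X = 1) \<and> (\<forall>a b s t. X (Inl (s, a)) (Inr (t, b)) = p a b s t)"
proof -
  obtain n l M N where bal: "balanced_form n l (M :: 's \<Rightarrow> 'a \<Rightarrow> complex mat) (N :: 't \<Rightarrow> 'b \<Rightarrow> complex mat)"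
    and p: "\<And>a b s t. p a b s t = Re (mat_trace (M s a * N t b))"
    using quantum_imp_balanced_form[OF assms] by metis
  have l1: "(\<Sum>i<n. (l i)\<^sup>2) = 1"
    and M: "\<And>s a. psd_mat n (M s a)" "\<And>s. mat_sum n (M s) = mat_diag n (\<lambda>i. complex_of_real (l i))"
    and N: "\<And>t b. psd_mat n (N t b)" "\<And>t. mat_sum n (N t) = mat_diag n (\<lambda>i. complex_of_real (l i))"
    using bal by (auto simp: balanced_form_def)
  note Mc = psd_matD(1)[OF M(1)] and Nc = psd_matD(1)[OF N(1)]
  define G :: "('a, 'b, 's, 't) index \<Rightarrow> complex mat"
    where "G u = (case u of Inl (s, a) \<Rightarrow> M s a | Inr (t, b) \<Rightarrow> N t b)" for u
  have G: "psd_mat n (G u)" for u using M(1) N(1) by (auto simp: G_def split: sum.split)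
  define X where "X u v = mat_trace (realification n (G u) * realification n (G v))" for u v
  have Xe: "X u v = Re (mat_trace (G u * G v))" for u v
    by (simp add: X_def trace_realification[OF G G])
  have "n \<noteq> 0" using l1 by (intro notI) simp
  then have "X \<in> cs_plus_cone"
    unfolding cs_plus_cone_def X_def
    by (intro CollectI exI[of _ "n + n"] conjI exI[of _ "\<lambda>u. realification n (G u)"])
      (auto simp: realification_psd[OF G])
  \<comment> \<open>All families, on either side and for every question, sum to the same diagonal
    matrix, so every kind of block totals the sum of the squares of \<open>l\<close>.\<close>
  moreover have "block_sum i j X = 1" for i j
    by (cases i; cases j)
      (simp_all add: block_sum_def Xe G_def l1 sum_trace_diag[OF Mc Mc M(2) M(2)] sum_trace_diag[OF Mc Nc M(2) N(2)]
          sum_trace_diag[OF Nc Mc N(2) M(2)] sum_trace_diag[OF Nc Nc N(2) N(2)])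
  moreover have "X (Inl (s, a)) (Inr (t, b)) = p a b s t" for a b s t
    by (simp add: Xe G_def p)
  ultimately show ?thesis by blast
qed

text \<open>At \<open>x + i y\<close> the complex form is the real form at \<open>x\<close> plus
  that at \<open>y\<close>; the mixed terms make up the imaginary part and cancel by
  symmetry.\<close>

lemma psd_mat_of_real:
  assumes M: "psd_mat n (M :: real mat)"
  shows "psd_mat n (map_mat complex_of_real M)"
proof -
  note c = psd_matD(1)[OF M]
  have sym: "M $$ (j, i) = M $$ (i, j)" if "i < n" "j < n" for i j
    using psd_matD(4)[OF M that] by simp
  have pos: "0 \<le> (\<Sum>i<n. \<Sum>j<n. M $$ (i, j) * v j * v i)" for v
    using M[unfolded psd_mat_iff, THEN conjunct2, THEN conjunct2, rule_format, of v] by simp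
  have "0 \<le> (\<Sum>i<n. \<Sum>j<n. map_mat complex_of_real M $$ (i, j) * v j * conjugate (v i))"
    (is "0 \<le> ?q") for v :: "nat \<Rightarrow> complex"
  proof -
    have q: "?q = (\<Sum>i<n. \<Sum>j<n. complex_of_real (M $$ (i, j)) * v j * cnj (v i))"
      using c by (intro sum.cong refl) simp
    have "Re ?q = (\<Sum>i<n. \<Sum>j<n. M $$ (i, j) * Re (v j) * Re (v i)) +
        (\<Sum>i<n. \<Sum>j<n. M $$ (i, j) * Im (v j) * Im (v i))"
      unfolding q sum.distrib[symmetric] Re_sum by (intro sum.cong refl) (simp add: algebra_simps)
    then have "0 \<le> Re ?q" using pos[of "\<lambda>i. Re (v i)"] pos[of "\<lambda>i. Im (v i)"] by simp
    moreover have "Im ?q = 0"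
    proof -
      have "Im ?q = (\<Sum>i<n. \<Sum>j<n. M $$ (i, j) * Im (v j) * Re (v i)) -
          (\<Sum>i<n. \<Sum>j<n. M $$ (i, j) * Re (v j) * Im (v i))"
        unfolding q sum_subtractf[symmetric] Im_sum by (intro sum.cong refl) (simp add: algebra_simps)
      also have "(\<Sum>i<n. \<Sum>j<n. M $$ (i, j) * Re (v j) * Im (v i)) =
          (\<Sum>i<n. \<Sum>j<n. M $$ (i, j) * Im (v j) * Re (v i))"
        by (subst sum.swap) (intro sum.cong refl, simp add: sym)
      finally show ?thesis by simp
    qed
    ultimately show ?thesis by (simp add: less_eq_complex_def)
  qed
  note nonneg = this
  have herm: "conjugate (map_mat complex_of_real M $$ (j, i)) = map_mat complex_of_real M $$ (i, j)"
    if "i < n" "j < n" for i j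
    using that c sym[OF that] by simp
  have "map_mat complex_of_real M \<in> carrier_mat n n" using c by simp
  then show ?thesis unfolding psd_mat_iff by (intro conjI allI impI nonneg herm)
qed

lemma cs_plus_imp_quantum:
  fixes X :: "('a::finite, 'b::finite, 's::finite, 't::finite) game_matrix"
  assumes "X \<in> cs_plus_cone" and bs: "\<And>i j. block_sum i j X = 1"
  shows "(\<lambda>a b s t. X (Inl (s, a)) (Inr (t, b))) \<in> quantum_correlations"
proof -
  obtain d M where M: "\<And>u. psd_mat d (M u)" and XM: "\<And>u v. X u v = mat_trace (M u * M v)"
    using assms(1) unfolding cs_plus_cone_def by blast
  note Mc = psd_matD(1)[OF M]
  have sym: "M u $$ (j, i) = M u $$ (i, j)" if "i < d" "j < d" for u i j
    using psd_matD(4)[OF M that] by simp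
  \<comment> \<open>Symmetry turns the trace into the entrywise inner product, so the matrices can
    be treated as vectors indexed by pairs.\<close>
  have Xe: "X u v = (\<Sum>ij\<in>{..<d} \<times> {..<d}. M u $$ ij * M v $$ ij)" for u v
  proof -
    have "X u v = (\<Sum>i<d. \<Sum>j<d. M u $$ (i, j) * M v $$ (i, j))"
      unfolding XM mat_trace_mult[OF Mc Mc] by (intro sum.cong refl) (simp add: sym)
    then show ?thesis by (simp add: sum.cartesian_product case_prod_beta)
  qed
  define W where "W k ij = (\<Sum>u\<in>block k. M u $$ ij)" for k :: "'s + 't" and ij
  have WW: "(\<Sum>ij\<in>{..<d} \<times> {..<d}. W k ij * W l ij) = 1" for k l
  proof -
    have "1 = (\<Sum>ij\<in>{..<d} \<times> {..<d}. \<Sum>u\<in>block k. \<Sum>v\<in>block l. M u $$ ij * M v $$ ij)"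
      unfolding bs[of k l, symmetric] block_sum_def Xe
      by (simp only: sum.swap[of _ "{..<d} \<times> {..<d}" "block _"])
    also have "\<dots> = (\<Sum>ij\<in>{..<d} \<times> {..<d}. W k ij * W l ij)"
      by (simp add: W_def sum_product)
    finally show ?thesis ..
  qed
  have W: "W k (i, j) = W l (i, j)" if "i < d" "j < d" for k l i j
    using unit_vectors_eq[of "{..<d} \<times> {..<d}" "W k" "W l" "(i, j)"] WW that by simp
  \<comment> \<open>The diagonalisation and the balanced form are complex, so the real matrices are
    embedded before the common block sum \<open>R\<close> is diagonalised.\<close>
  define C where "C u = map_mat complex_of_real (M u)" for u
  have C: "psd_mat d (C u)" for u unfolding C_def by (rule psd_mat_of_real[OF M])
  define R where "R = mat d d (\<lambda>ij. complex_of_real (W (Inl undefined) ij))"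
  have CR: "mat_sum d (\<lambda>a. C (Inl (s, a))) = R" "mat_sum d (\<lambda>b. C (Inr (t, b))) = R" for s t
  proof -
    have entry: "C u $$ (i, j) = complex_of_real (M u $$ (i, j))" if "i < d" "j < d" for u i j
      using that Mc[of u] by (simp add: C_def)
    show "mat_sum d (\<lambda>a. C (Inl (s, a))) = R"
    proof (rule eq_matI)
      fix i j assume "i < dim_row R" "j < dim_col R"
      then have ij: "i < d" "j < d" by (simp_all add: R_def)
      show "mat_sum d (\<lambda>a. C (Inl (s, a))) $$ (i, j) = R $$ (i, j)"
        using ij W[OF ij, of "Inl undefined" "Inl s"] by (simp add: R_def entry) (simp add: W_def)
    qed (simp_all add: R_def)
    show "mat_sum d (\<lambda>b. C (Inr (t, b))) = R"
    proof (rule eq_matI)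
      fix i j assume "i < dim_row R" "j < dim_col R"
      then have ij: "i < d" "j < d" by (simp_all add: R_def)
      show "mat_sum d (\<lambda>b. C (Inr (t, b))) $$ (i, j) = R $$ (i, j)"
        using ij W[OF ij, of "Inl undefined" "Inr t"] by (simp add: R_def entry) (simp add: W_def)
    qed (simp_all add: R_def)
  qed
  have "psd_mat d R" using psd_mat_sum[of d "\<lambda>a. C (Inl (undefined, a))"] C by (simp add: CR)
  then obtain U l where U: "U \<in> carrier_mat d d" "mat_adjoint U * U = 1\<^sub>m d"
    and l: "\<And>i. i < d \<Longrightarrow> 0 \<le> l i" "mat_adjoint U * R * U = mat_diag d (\<lambda>i. complex_of_real (l i))"
    using psd_mat_diagonalization by blast
  have U': "mat_adjoint U \<in> carrier_mat d d" using U by simp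
  define G where "G u = mat_adjoint U * C u * U" for u
  have G: "psd_mat d (G u)" for u unfolding G_def by (rule psd_mat_congruence[OF C U(1)])
  have GD: "mat_sum d (\<lambda>a. G (Inl (s, a))) = mat_diag d (\<lambda>i. complex_of_real (l i))"
    "mat_sum d (\<lambda>b. G (Inr (t, b))) = mat_diag d (\<lambda>i. complex_of_real (l i))" for s t
    unfolding G_def mat_sum_congruence[OF psd_matD(1)[OF C] U' U(1)] CR l(2) by (rule refl)+
  have GX: "Re (mat_trace (G u * G v)) = X u v" for u v
  proof -
    have "mat_trace (G u * G v) = mat_trace (C u * C v)"
      unfolding G_def by (rule mat_trace_unitary_conjugation[OF U psd_matD(1)[OF C] psd_matD(1)[OF C]])
    also have "\<dots> = complex_of_real (mat_trace (M u * M v))"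
      unfolding mat_trace_mult[OF psd_matD(1)[OF C] psd_matD(1)[OF C]] mat_trace_mult[OF Mc Mc] of_real_sum
      using Mc[of u] Mc[of v] by (intro sum.cong refl) (simp add: C_def)
    finally show ?thesis by (simp add: XM)
  qed
  \<comment> \<open>The normalisation of \<open>l\<close> is the block sum condition at one
    arbitrary question pair.\<close>
  have "(\<Sum>i<d. (l i)\<^sup>2) = block_sum (Inl undefined) (Inr undefined) X"
    unfolding block_sum_def sum_block GX[symmetric]
    by (rule sum_trace_diag[OF psd_matD(1)[OF G] psd_matD(1)[OF G] GD, symmetric])
  then have "balanced_form d l (\<lambda>s a. G (Inl (s, a))) (\<lambda>t b. G (Inr (t, b)))"
    using bs l(1) G GD by (simp add: balanced_form_def)
  from balanced_form_imp_quantum[OF this] show ?thesis by (simp add: GX)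
qed

theorem corollary4p7:
  fixes \<pi> :: "'s::finite \<Rightarrow> 't::finite \<Rightarrow> real"
    and V :: "'a::finite \<Rightarrow> 'b::finite \<Rightarrow> 's \<Rightarrow> 't \<Rightarrow> bool"
  assumes "prob_distribution \<pi>"
  shows "(admits_perfect_strategy classical_correlations \<pi> V \<longleftrightarrow> conic_feasible cp_cone \<pi> V) \<and>
         (admits_perfect_strategy quantum_correlations \<pi> V \<longleftrightarrow> conic_feasible cs_plus_cone \<pi> V) \<and>
         (admits_perfect_strategy no_signaling_correlations \<pi> V \<longleftrightarrow> conic_feasible nso_cone \<pi> V) \<and>
         (admits_perfect_strategy unrestricted_correlations \<pi> V \<longleftrightarrow> conic_feasible nonneg_cone \<pi> V)"
proof (intro conjI perfect_strategy_iff_conic_feasible[OF assms])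
  show "classical_correlations \<subseteq> unrestricted_correlations" "quantum_correlations \<subseteq> unrestricted_correlations"
    "no_signaling_correlations \<subseteq> unrestricted_correlations"
    by (auto simp: classical_correlations_def quantum_correlations_def no_signaling_correlations_def)
next
  fix p :: "('a, 'b, 's, 't) correlation"
  assume p: "p \<in> no_signaling_correlations"
  \<comment> \<open>The mixed block of the extension is \<open>p\<close> itself, so the equations of
    the cone are the no-signaling conditions on \<open>p\<close>.\<close>
  then have "uniform_extension p \<in> nso_cone"
    using uniform_extension_feasible(1)[of p]
    by (auto simp: no_signaling_correlations_def nso_cone_def)
  then show "\<exists>X\<in>nso_cone. (\<forall>i j. block_sum i j X = 1) \<and> (\<forall>a b s t. X (Inl (s, a)) (Inr (t, b)) = p a b s t)"
    using p uniform_extension_feasible(2)[of p]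
    by (auto simp: no_signaling_correlations_def intro!: bexI[of _ "uniform_extension p"])
next
  fix X :: "('a, 'b, 's, 't) game_matrix"
  assume "X \<in> nso_cone" "\<And>i j. block_sum i j X = 1"
  then show "(\<lambda>a b s t. X (Inl (s, a)) (Inr (t, b))) \<in> no_signaling_correlations"
    using nonneg_imp_unrestricted[of X] by (auto simp: no_signaling_correlations_def nso_cone_def)
next
  fix p :: "('a, 'b, 's, 't) correlation"
  assume "p \<in> unrestricted_correlations"
  then show "\<exists>X\<in>nonneg_cone. (\<forall>i j. block_sum i j X = 1) \<and> (\<forall>a b s t. X (Inl (s, a)) (Inr (t, b)) = p a b s t)"
    using uniform_extension_feasible[of p] by (auto intro!: bexI[of _ "uniform_extension p"])
qed (simp_all add: classical_imp_cp cp_imp_classical quantum_imp_cs_plus cs_plus_imp_quantum nonneg_imp_unrestricted)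

end
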